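(* Let $q=4$, $r=2$, $\rho=2$, $\eta>0$, and let $u$ be the regularized ReLU-network objective defined in the context. Let $X=(Y,Z)$ be continuously distributed with law $\mathcal{L}(X)$. Assume that for every $I=1,\dots,m_2$ and $K=1,\dots,m_1$ there exist constants $C_{Z^K},\bar C_{Z^K}>0$ such that, for all $z=(z^1,\dots,z^{m_1})\in\mathbb{R}^{m_1}$ and $y^I\in\mathbb{R}$, $$f_{Z^K|Z_{-K},Y^I}(z^K|z_{-K},y^I)\le C_{Z^K},\qquad |z^K|^2f_{Z^K|Z_{-K},Y^I}(z^K|z_{-K},y^I)\le\bar C_{Z^K},$$ where $f_{Z^K|Z_{-K},Y^I}$ is the density function of $Z^K$ given $Z_{-K}:=(Z^1,\dots,Z^{K-1},Z^{K+1},\dots,Z^{m_1})$ and $Y^I$. Let $(X_n)_{n\in\mathbb{N}_0}=(Y_n,Z_n)_{n\in\mathbb{N}_0}$ be i.i.d. with law $\mathcal{L}(X)$, let $\theta_0$ be an $\mathbb{R}^d$-valued random variable, and assume $\mathbb{E}[|\theta_0|^{20}+|X_0|^{40}]<\infty$. Let $H:=F+G:\mathbb{R}^d\times\mathbb{R}^m\to\mathbb{R}^d$ with $F,G$ as defined in the context. Then: (i) $u$ is continuously differentiable; moreover, with $h:=\nabla u$, one has $\mathbb{E}[|\theta_0|^{4(2r+1)}]<\infty$, $\mathbb{E}[|X_0|^{4(2r+1)\rho}]<\infty$, and $h(\theta)=\mathbb{E}[H(\theta,X_0)]$ for all $\theta\in\mathbb{R}^d$. (ii) For all $\theta,\theta'\in\mathbb{R}^d$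 and $x\in\mathbb{R}^m$, $$\mathbb{E}[|G(\theta,X_0)-G(\theta',X_0)|]\le L_G(1+|\theta|+|\theta'|)^{q-1}|\theta-\theta'|,\qquad |G(\theta,x)|\le K_G(1+|x|)^\rho(1+|\theta|)^q,$$ with $L_G=55m_2d_1^2(1+c_F)^2(1+C_{Z,\max}+\bar C_{Z,\max})\mathbb{E}[(1+|X_0|)^2]$ and $K_G=8m_2d_1^2(1+c_F)^2$, where $$C_{Z,\max}:=\max_{J\in\{1,\dots,d_1\}}\{C_{Z^{\nu_J}}/|c^{J\nu_J}|\},\qquad\bar C_{Z,\max}:=\max_{J\in\{1,\dots,d_1\}}\{\bar C_{Z^{\nu_J}}/|c^{J\nu_J}|\},$$ and $\nu_J:=\min\{K\in\{1,\dots,m_1\}:c^{JK}\ne0\}$ for $J=1,\dots,d_1$. (iii) With $L_F=5\eta$, $K_F=\eta$, for all $\theta,\theta'\in\mathbb{R}^d$, $x,x'\in\mathbb{R}^m$, $$|F(\theta,x)-F(\theta',x')|\le L_F(1+|x|+|x'|)^{\rho-1}(1+|\theta|+|\theta'|)^{2r}(|\theta-\theta'|+|x-x'|),\qquad|F(\theta,x)|\le K_F(1+|x|)^\rho(1+|\theta|^{2r+1}).$$ (iv) With $A(x)=\eta I_d/2$, $B(x)=0$ for all $x\in\mathbb{R}^m$, $\bar r=0$, $a=\eta/2$, $b=0$: $\langle y,A(x)y\rangle\ge0$ and $\langle y,B(x)y\rangle\ge0$ for all $x\in\mathbb{R}^m$, $y\in\mathbb{R}^d$; for all $\theta,\theta'\in\mathbb{R}^d$,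 $x\in\mathbb{R}^m$, $$\langle\theta-\theta',F(\theta,x)-F(\theta',x)\rangle\ge\langle\theta-\theta',A(x)(\theta-\theta')\rangle(|\theta|^{2r}+|\theta'|^{2r})-\langle\theta-\theta',B(x)(\theta-\theta')\rangle(|\theta|^{\bar r}+|\theta'|^{\bar r});$$ and the smallest eigenvalue of $\mathbb{E}[A(X_0)]$ is $a>0$ and the largest eigenvalue of $\mathbb{E}[B(X_0)]$ is $b\ge0$.
   Context: $|\cdot|$, $\langle\cdot,\cdot\rangle$ are the Euclidean norm and scalar product; $I_d$ is the identity matrix. Let $d_1,m_1,m_2\in\mathbb{N}$, $m:=m_1+m_2$, $d:=d_1(1+m_2)$. $X=(Y,Z)$ is an $\mathbb{R}^m$-valued random variable with $Y=(Y^1,\dots,Y^{m_2})\in\mathbb{R}^{m_2}$ and $Z=(Z^1,\dots,Z^{m_1})\in\mathbb{R}^{m_1}$. Network: $\mathfrak{N}=(\mathfrak{N}^1,\dots,\mathfrak{N}^{m_2}):\mathbb{R}^d\times\mathbb{R}^{m_1}\to\mathbb{R}^{m_2}$ with $\mathfrak{N}^i(\theta,z):=\sum_{j=1}^{d_1}W_1^{ij}\sigma_1(\langle c^{j\cdot},z\rangle+b_0^j)$, where $\sigma_1(\nu):=\max\{0,\nu\}$ (ReLU), $c=(c^{jk})\in\mathbb{R}^{d_1\times m_1}$ is a fixed matrix with rows $c^{j\cdot}$, each row of which has at least one nonzero entry, and with Frobenius norm $c_F$; the parameter is $\theta=([W_1],b_0)\in\mathbb{R}^d$, with bias $b_0=(b_0^1,\dots,b_0^{d_1})\in\mathbb{R}^{d_1}$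 and $[W_1]$ the vector of all entries of the weight matrix $W_1=(W_1^{ij})\in\mathbb{R}^{m_2\times d_1}$. Objective: $u(\theta):=\mathbb{E}[|Y-\mathfrak{N}(\theta,Z)|^2]+\frac{\eta}{2(r+1)}|\theta|^{2(r+1)}$, $\theta\in\mathbb{R}^d$. Stochastic gradient components: for $x=(y,z)$, $y=(y^1,\dots,y^{m_2})\in\mathbb{R}^{m_2}$, $z\in\mathbb{R}^{m_1}$, $F(\theta,x):=\eta\theta|\theta|^{2r}$ and $G(\theta,x):=(G_{W_1^{11}}(\theta,x),\dots,G_{W_1^{m_2d_1}}(\theta,x),G_{b_0^1}(\theta,x),\dots,G_{b_0^{d_1}}(\theta,x))$ where, for $I=1,\dots,m_2$, $J=1,\dots,d_1$, $G_{W_1^{IJ}}(\theta,x):=-2(y^I-\mathfrak{N}^I(\theta,z))\sigma_1(\langle c^{J\cdot},z\rangle+b_0^J)$, $G_{b_0^J}(\theta,x):=-2\sum_{i=1}^{m_2}(y^i-\mathfrak{N}^i(\theta,z))W_1^{iJ}\mathbf{1}_{A_J}(z)$, with $A_J:=\{z\in\mathbb{R}^{m_1}:\langle c^{J\cdot},z\rangle+b_0^J\ge0\}$. *)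

theory Defs
  imports "HOL-Probability.Probability"
begin

(* The dimensions d_1, m_1, m_2 are the cardinalities of the index types 'd, 'k, 'i.

   Parameters live in R^(d_1 (1 + m_2)): coordinate Inl (i, j) is the entry W_1^{ij},
   coordinate Inr j is the bias b_0^j.  Data x = (y, z) live in R^{m_2} x R^{m_1}, whose
   product norm is the Euclidean norm of R^{m_1 + m_2}.  For c :: real^'k^'d, the row c^{j.}
   is c $ j, and norm c is the Frobenius norm. *)

type_synonym ('i, 'd) par = "(real, ('i \<times> 'd) + 'd) vec"
type_synonym ('i, 'k) dat = "(real, 'i) vec \<times> (real, 'k) vec"

definition relu :: "real \<Rightarrow> real" where
  "relu v = max 0 v"

definition network ::
  "real^'k^'d \<Rightarrow> ('i::finite, 'd::finite) par \<Rightarrow> real^'k::finite \<Rightarrow> real^'i" where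
  "network c \<theta> z =
     (\<chi> i. \<Sum>j\<in>UNIV. \<theta> $ Inl (i, j) * relu (c $ j \<bullet> z + \<theta> $ Inr j))"

definition objective ::
  "'a measure \<Rightarrow> ('a \<Rightarrow> ('i::finite, 'k::finite) dat) \<Rightarrow> real^'k^'d \<Rightarrow> real \<Rightarrow> nat
     \<Rightarrow> ('i, 'd::finite) par \<Rightarrow> real" where
  "objective M X c \<eta> r \<theta> =
     (\<integral>\<omega>. (norm (fst (X \<omega>) - network c \<theta> (snd (X \<omega>))))\<^sup>2 \<partial>M)
       + \<eta> / (2 * (real r + 1)) * norm \<theta> ^ (2 * (r + 1))"

definition active_set ::
  "real^'k^'d \<Rightarrow> ('i::finite, 'd::finite) par \<Rightarrow> 'd \<Rightarrow> (real^'k::finite) set" where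
  "active_set c \<theta> J = {z. c $ J \<bullet> z + \<theta> $ Inr J \<ge> 0}"

definition F_grad ::
  "real \<Rightarrow> nat \<Rightarrow> ('i::finite, 'd::finite) par \<Rightarrow> ('i, 'k::finite) dat \<Rightarrow> ('i, 'd) par" where
  "F_grad \<eta> r \<theta> x = (\<eta> * norm \<theta> ^ (2 * r)) *\<^sub>R \<theta>"

definition G_grad ::
  "real^'k^'d \<Rightarrow> ('i::finite, 'd::finite) par \<Rightarrow> ('i, 'k::finite) dat \<Rightarrow> ('i, 'd) par" where
  "G_grad c \<theta> x = (\<chi> l. case l of
       Inl (I, J) \<Rightarrow>
         - 2 * (fst x $ I - network c \<theta> (snd x) $ I) * relu (c $ J \<bullet> snd x + \<theta> $ Inr J)
     | Inr J \<Rightarrow>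
         - 2 * (\<Sum>i\<in>UNIV. (fst x $ i - network c \<theta> (snd x) $ i) * \<theta> $ Inl (i, J)
                  * indicator (active_set c \<theta> J) (snd x)))"

definition H_grad ::
  "real^'k^'d \<Rightarrow> real \<Rightarrow> nat \<Rightarrow> ('i::finite, 'd::finite) par \<Rightarrow> ('i, 'k::finite) dat
     \<Rightarrow> ('i, 'd) par" where
  "H_grad c \<eta> r \<theta> x = F_grad \<eta> r \<theta> x + G_grad c \<theta> x"

(* f is a version of the Lebesgue density of the real random variable U given the S-valued
   random variable W: f (. | w) is a density of the conditional law of U given W = w, for
   almost every w under the law of W.  Conditional densities are determined only almost
   everywhere, hence a predicate and not a function. *)
definition conditional_density ::
  "'a measure \<Rightarrow> 'b measure \<Rightarrow> ('a \<Rightarrow> real) \<Rightarrow> ('a \<Rightarrow> 'b) \<Rightarrow> (real \<Rightarrow> 'b \<Rightarrow> real) \<Rightarrow> bool" where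
  "conditional_density M S U W f \<longleftrightarrow>
     U \<in> borel_measurable M \<and> W \<in> measurable M S \<and>
     (\<lambda>(u, w). f u w) \<in> borel_measurable (borel \<Otimes>\<^sub>M S) \<and>
     (\<forall>u. \<forall>w\<in>space S. 0 \<le> f u w) \<and>
     (\<forall>A\<in>sets borel. \<forall>B\<in>sets S.
        emeasure M {\<omega>\<in>space M. U \<omega> \<in> A \<and> W \<omega> \<in> B}
          = (\<integral>\<^sup>+w\<in>B. (\<integral>\<^sup>+u\<in>A. ennreal (f u w) \<partial>lborel) \<partial>distr M S W))"

(* The vector z_{-K}, as a function on the indices different from K. *)
definition drop_coord :: "'k \<Rightarrow> real^'k::finite \<Rightarrow> 'k \<Rightarrow> real" where
  "drop_coord K z = (\<lambda>k\<in>- {K}. z $ k)"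

definition first_nonzero :: "real^'k::{finite, linorder}^'d::finite \<Rightarrow> 'd \<Rightarrow> 'k" where
  "first_nonzero c J = Min {K. c $ J $ K \<noteq> 0}"

definition eigenvalues :: "real^'n^'n::finite \<Rightarrow> real set" where
  "eigenvalues S = {l. \<exists>v. v \<noteq> 0 \<and> S *v v = l *\<^sub>R v}"

end

theory Submission
  imports Defs
begin

text \<open>
  Everything about the regularizer is elementary. The content lies in the bias part of the stochastic
  gradient \<open>G\<close>, which contains the indicator of \<open>c\<^sub>J \<bullet> z + b\<^sub>J \<ge> 0\<close> and is therefore discontinuous in
  the bias \<open>b\<^sub>J\<close>, so that \<open>G\<close> can only be Lipschitz in expectation.

  The increment of \<open>G\<close> between \<open>\<theta>\<close> and \<open>\<theta>'\<close> splits pointwise into a part that is locally Lipschitz,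
  with constant of order \<open>(1 + \<bar>x\<bar>)\<^sup>2\<close>, and a part supported on the strips where \<open>c\<^sub>J \<bullet> z\<close> lies
  between \<open>- b\<^sub>J\<close> and \<open>- b'\<^sub>J\<close> (\<open>G_grad_diff_le\<close>). Choose \<open>K\<close> with \<open>c\<^sub>J\<^sub>K \<noteq> 0\<close>. Conditionally on the other
  coordinates of \<open>Z\<close> and on one output coordinate \<open>Y\<^sub>I\<close>, the strip confines \<open>Z\<^sub>K\<close> to an interval of length
  \<open>\<bar>b\<^sub>J - b'\<^sub>J\<bar> / \<bar>c\<^sub>J\<^sub>K\<bar>\<close>. On it the weight \<open>1 + \<bar>Y\<^sub>I\<bar> + \<bar>Z\<bar>\<close> is at most affine in \<open>\<bar>Z\<^sub>K\<bar>\<close>, and the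
  bounds on the conditional density \<open>f(z)\<close> and on \<open>z\<^sup>2 f(z)\<close> make its integral linear in the length
  (\<open>strip_nn_integral_le\<close>, \<open>strip_expectation_le\<close>). Summing gives the expected Lipschitz
  bound \<open>G_grad_expectation_lipschitz\<close>.

  A strip of width zero is a hyperplane, so the same estimate shows that almost surely no preactivation
  vanishes (\<open>hyperplane_null\<close>). Hence the squared residual is almost surely differentiable at
  any given \<open>\<theta>\<close>, with gradient \<open>G\<close> (\<open>GDERIV_squared_residual\<close>). Its difference quotients are dominated
  (\<open>squared_residual_lipschitz\<close>), and dominated convergence shows that the objective has gradient
  \<open>\<theta> \<mapsto> E[H(\<theta>, X\<^sub>0)]\<close>. This gradient is continuous by the expected Lipschitz bound.
\<close>

section \<open>Growth and increments of the network\<close>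

lemma relu_abs_le: "\<bar>relu v\<bar> \<le> \<bar>v\<bar>"
  by (simp add: relu_def)

lemma relu_diff_le: "\<bar>relu u - relu v\<bar> \<le> \<bar>u - v\<bar>"
  by (simp add: relu_def max_def)

lemma sum_par_index:
  fixes g :: "('i::finite \<times> 'd::finite) + 'd \<Rightarrow> real"
  shows "(\<Sum>l\<in>UNIV. g l) = (\<Sum>I\<in>UNIV. \<Sum>J\<in>UNIV. g (Inl (I, J))) + (\<Sum>J\<in>UNIV. g (Inr J))"
proof -
  have "(\<Sum>l\<in>UNIV. g l) = (\<Sum>p\<in>UNIV. g (Inl p)) + (\<Sum>J\<in>UNIV. g (Inr J))"
    by (simp add: UNIV_Plus_UNIV[symmetric] sum.Plus del: UNIV_Plus_UNIV)
  also have "(\<Sum>p\<in>UNIV. g (Inl p)) = (\<Sum>I\<in>UNIV. \<Sum>J\<in>UNIV. g (Inl (I, J)))"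
    by (simp add: sum.cartesian_product UNIV_Times_UNIV[symmetric] del: UNIV_Times_UNIV)
  finally show ?thesis .
qed

text \<open>The \<open>\<ell>\<^sup>1\<close> bound on the norm of a parameter vector. The weight and bias coordinates are treated
  differently because the increments of the bias part of the gradient depend on \<open>J\<close> through an
  indicator.\<close>

lemma norm_par_le:
  fixes v :: "('i::finite, 'd::finite) par"
  assumes "\<And>I J. \<bar>v $ Inl (I, J)\<bar> \<le> \<alpha>" and "\<And>J. \<bar>v $ Inr J\<bar> \<le> \<beta> J"
  shows "norm v \<le> real CARD('i) * real CARD('d) * \<alpha> + (\<Sum>J\<in>UNIV. \<beta> J)"
proof -
  have "norm v \<le> (\<Sum>I\<in>UNIV. \<Sum>J\<in>UNIV. \<bar>v $ Inl (I, J)\<bar>) + (\<Sum>J\<in>UNIV. \<bar>v $ Inr J\<bar>)"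
    using norm_le_l1_cart[of v] by (simp add: sum_par_index)
  also have "\<dots> \<le> (\<Sum>I\<in>(UNIV::'i set). \<Sum>J\<in>(UNIV::'d set). \<alpha>) + (\<Sum>J\<in>UNIV. \<beta> J)"
    by (intro add_mono sum_mono assms)
  finally show ?thesis by (simp add: mult.assoc)
qed

lemma preactivation_bound:
  fixes c :: "real^'k::finite^'d::finite" and \<theta> :: "('i::finite, 'd) par"
  shows "\<bar>c $ j \<bullet> z + \<theta> $ Inr j\<bar> \<le> (1 + norm c) * (1 + norm z) * (1 + norm \<theta>)"
proof -
  have "\<bar>c $ j \<bullet> z\<bar> \<le> norm c * norm z"
    using Cauchy_Schwarz_ineq2[of "c $ j" z] Finite_Cartesian_Product.norm_nth_le[of c j]
    by (meson mult_right_mono norm_ge_zero order_trans)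
  moreover have "\<bar>\<theta> $ Inr j\<bar> \<le> norm \<theta>" by (rule component_le_norm_cart)
  ultimately have "\<bar>c $ j \<bullet> z + \<theta> $ Inr j\<bar> \<le> norm c * norm z + norm \<theta>" by linarith
  also have "\<dots> \<le> (1 + norm c) * (1 + norm z) * (1 + norm \<theta>)"
    by (simp add: algebra_simps)
  finally show ?thesis .
qed

lemma activation_bound:
  fixes c :: "real^'k::finite^'d::finite" and \<theta> :: "('i::finite, 'd) par"
  shows "\<bar>relu (c $ j \<bullet> z + \<theta> $ Inr j)\<bar> \<le> (1 + norm c) * (1 + norm z) * (1 + norm \<theta>)"
  using relu_abs_le preactivation_bound by (rule order_trans)

lemma activation_lipschitz:
  fixes c :: "real^'k::finite^'d::finite" and \<theta> \<theta>' :: "('i::finite, 'd) par"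
  shows "\<bar>relu (c $ j \<bullet> z + \<theta> $ Inr j) - relu (c $ j \<bullet> z + \<theta>' $ Inr j)\<bar> \<le> norm (\<theta> - \<theta>')"
  using relu_diff_le[of "c $ j \<bullet> z + \<theta> $ Inr j" "c $ j \<bullet> z + \<theta>' $ Inr j"]
    component_le_norm_cart[of "\<theta> - \<theta>'" "Inr j"] by simp

lemma residual_bound:
  fixes c :: "real^'k::finite^'d::finite" and \<theta> :: "('i::finite, 'd) par"
  shows "\<bar>t - network c \<theta> z $ i\<bar>
    \<le> real CARD('d) * (1 + norm c) * (1 + \<bar>t\<bar> + norm z) * (1 + norm \<theta>)\<^sup>2"
proof -
  have "\<bar>network c \<theta> z $ i\<bar> \<le> (\<Sum>j\<in>(UNIV::'d set). \<bar>\<theta> $ Inl (i, j) * relu (c $ j \<bullet> z + \<theta> $ Inr j)\<bar>)"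
    unfolding network_def by (simp add: sum_abs)
  also have "\<dots> \<le> (\<Sum>j\<in>(UNIV::'d set). norm \<theta> * ((1 + norm c) * (1 + norm z) * (1 + norm \<theta>)))"
    unfolding abs_mult
    by (intro sum_mono mult_mono component_le_norm_cart activation_bound) auto
  finally have N: "\<bar>network c \<theta> z $ i\<bar>
      \<le> real CARD('d) * (1 + norm c) * (1 + norm z) * (norm \<theta> * (1 + norm \<theta>))"
    by (simp add: mult_ac)
  have d1: "1 \<le> real CARD('d)" by (simp add: Suc_leI)
  define P where "P = real CARD('d) * (1 + norm c)"
  have P: "1 \<le> P" unfolding P_def using mult_mono[of 1 "real CARD('d)" 1 "1 + norm c"] d1 by simp
  have S: "1 \<le> (1 + norm \<theta>)\<^sup>2" by (simp add: one_le_power)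
  have "\<bar>t\<bar> \<le> P * \<bar>t\<bar> * (1 + norm \<theta>)\<^sup>2"
    using mult_mono[OF mult_right_mono[OF P, of "\<bar>t\<bar>"] S] P by simp
  moreover have "\<bar>network c \<theta> z $ i\<bar> \<le> P * (1 + norm z) * (1 + norm \<theta>)\<^sup>2"
  proof -
    have "P * (1 + norm z) * (norm \<theta> * (1 + norm \<theta>)) \<le> P * (1 + norm z) * (1 + norm \<theta>)\<^sup>2"
      using P by (intro mult_left_mono) (auto simp: power2_eq_square intro!: mult_right_mono)
    then show ?thesis using N unfolding P_def by linarith
  qed
  ultimately show ?thesis unfolding P_def[symmetric] by (simp add: algebra_simps)
qed

lemma network_lipschitz:
  fixes c :: "real^'k::finite^'d::finite" and \<theta> \<theta>' :: "('i::finite, 'd) par"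
  shows "\<bar>network c \<theta> z $ i - network c \<theta>' z $ i\<bar>
    \<le> 2 * real CARD('d) * (1 + norm c) * (1 + norm z) * (1 + norm \<theta> + norm \<theta>') * norm (\<theta> - \<theta>')"
proof -
  let ?s = "\<lambda>\<theta> j. relu (c $ j \<bullet> z + (\<theta>::('i, 'd) par) $ Inr j)"
  let ?B = "(1 + norm c) * (1 + norm z) * (1 + norm \<theta> + norm \<theta>')"
  have B1: "norm \<theta>' \<le> ?B"
  proof -
    have "1 \<le> (1 + norm c) * (1 + norm z)"
      using mult_mono[of 1 "1 + norm c" 1 "1 + norm z"] by simp
    from mult_mono[OF this, of "norm \<theta>'" "1 + norm \<theta> + norm \<theta>'"] show ?thesis by simp
  qed
  have eq: "network c \<theta> z $ i - network c \<theta>' z $ i =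
      (\<Sum>j\<in>UNIV. (\<theta> - \<theta>') $ Inl (i, j) * ?s \<theta> j + \<theta>' $ Inl (i, j) * (?s \<theta> j - ?s \<theta>' j))"
    unfolding network_def by (simp add: sum_subtractf[symmetric] algebra_simps)
  have "\<bar>network c \<theta> z $ i - network c \<theta>' z $ i\<bar>
      \<le> (\<Sum>j\<in>(UNIV::'d set). norm (\<theta> - \<theta>') * ?B + ?B * norm (\<theta> - \<theta>'))"
    unfolding eq
  proof (rule order_trans[OF sum_abs], rule sum_mono)
    fix j :: 'd
    have s: "\<bar>?s \<theta> j\<bar> \<le> ?B"
      using activation_bound[of c j z \<theta>]
      by (rule order_trans) (auto intro!: mult_left_mono)
    have "\<bar>(\<theta> - \<theta>') $ Inl (i, j) * ?s \<theta> j\<bar> \<le> norm (\<theta> - \<theta>') * ?B"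
      unfolding abs_mult by (intro mult_mono component_le_norm_cart s) auto
    moreover have "\<bar>\<theta>' $ Inl (i, j) * (?s \<theta> j - ?s \<theta>' j)\<bar> \<le> ?B * norm (\<theta> - \<theta>')"
      unfolding abs_mult
      by (intro mult_mono activation_lipschitz order_trans[OF component_le_norm_cart B1]) auto
    ultimately show "\<bar>(\<theta> - \<theta>') $ Inl (i, j) * ?s \<theta> j + \<theta>' $ Inl (i, j) * (?s \<theta> j - ?s \<theta>' j)\<bar>
        \<le> norm (\<theta> - \<theta>') * ?B + ?B * norm (\<theta> - \<theta>')" by linarith
  qed
  also have "\<dots> = 2 * real CARD('d) * (1 + norm c) * (1 + norm z) * (1 + norm \<theta> + norm \<theta>')
      * norm (\<theta> - \<theta>')"
  proof -
    have "N * (\<delta> * (p * z * s) + p * z * s * \<delta>) = 2 * N * p * z * s * \<delta>"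
      for N \<delta> p z s :: real by simp
    then show ?thesis by (simp only: sum_constant)
  qed
  finally show ?thesis .
qed

lemma one_plus_data_le:
  fixes x :: "('i::finite, 'k::finite) dat"
  shows "1 + \<bar>fst x $ i\<bar> + norm (snd x) \<le> 2 * (1 + norm x)"
  using component_le_norm_cart[of "fst x" i] norm_fst_le[of "fst x" "snd x"] norm_snd_le[of "snd x" "fst x"]
  by simp

section \<open>Growth and increments of the stochastic gradient\<close>

lemma G_grad_bound:
  fixes c :: "real^'k::finite^'d::finite" and \<theta> :: "('i::finite, 'd) par"
  shows "norm (G_grad c \<theta> x)
    \<le> 8 * real CARD('i) * (real CARD('d))\<^sup>2 * (1 + norm c)\<^sup>2 * (1 + norm x)\<^sup>2 * (1 + norm \<theta>) ^ 4"
proof -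
  define D where "D = real CARD('d)"
  define P where "P = 1 + norm c"
  define R where "R = 1 + norm x"
  define T where "T = 1 + norm \<theta>"
  have D: "1 \<le> D" unfolding D_def by (simp add: Suc_leI)
  have P: "1 \<le> P" and R: "1 \<le> R" and T: "1 \<le> T" unfolding P_def R_def T_def by auto
  define E where "E = 2 * D * P\<^sup>2 * R\<^sup>2 * T ^ 4"
  have e: "\<bar>fst x $ i - network c \<theta> (snd x) $ i\<bar> \<le> 2 * D * P * R * T\<^sup>2" for i
  proof -
    have "D * P * (1 + \<bar>fst x $ i\<bar> + norm (snd x)) * T\<^sup>2 \<le> D * P * (2 * R) * T\<^sup>2"
      using one_plus_data_le[of x i] D P T unfolding R_def
      by (intro mult_right_mono mult_left_mono) auto
    then show ?thesis
      using residual_bound[of "fst x $ i" c \<theta> "snd x" i] unfolding D_def P_def T_def by linarith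
  qed
  have s: "\<bar>relu (c $ J \<bullet> snd x + \<theta> $ Inr J)\<bar> \<le> P * R * T" for J
  proof -
    have "P * (1 + norm (snd x)) * T \<le> P * R * T"
      using norm_snd_le[of "snd x" "fst x"] P T unfolding R_def
      by (intro mult_right_mono mult_left_mono) auto
    then show ?thesis using activation_bound[of c J "snd x" \<theta>] unfolding P_def T_def by linarith
  qed
  have w: "\<bar>\<theta> $ l\<bar> \<le> T" for l
    using component_le_norm_cart[of \<theta> l] unfolding T_def by simp
  have b1: "2 * D * P * R * T\<^sup>2 * (P * R * T) \<le> E"
  proof -
    have "2 * D * P * R * T\<^sup>2 * (P * R * T) = 2 * D * P\<^sup>2 * R\<^sup>2 * T ^ 3"
      by (simp add: power2_eq_square power3_eq_cube)
    also have "\<dots> \<le> E" unfolding E_def using D P R T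
      by (intro mult_mono power_increasing) auto
    finally show ?thesis .
  qed
  have b2: "2 * D * P * R * T\<^sup>2 * T \<le> E"
  proof -
    have "2 * D * P * R * T\<^sup>2 * T = 2 * D * P ^ 1 * R ^ 1 * T ^ 3"
      by (simp add: power2_eq_square power3_eq_cube)
    also have "\<dots> \<le> E" unfolding E_def using D P R T
      by (intro mult_mono power_increasing) auto
    finally show ?thesis .
  qed
  have "norm (G_grad c \<theta> x)
      \<le> real CARD('i) * real CARD('d) * (2 * E) + (\<Sum>J\<in>(UNIV::'d set). real CARD('i) * (2 * E))"
  proof (rule norm_par_le)
    fix I J
    have "\<bar>fst x $ I - network c \<theta> (snd x) $ I\<bar> * \<bar>relu (c $ J \<bullet> snd x + \<theta> $ Inr J)\<bar>
        \<le> 2 * D * P * R * T\<^sup>2 * (P * R * T)"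
      using D P R T by (intro mult_mono e s) auto
    also note b1
    finally have "2 * (\<bar>fst x $ I - network c \<theta> (snd x) $ I\<bar> * \<bar>relu (c $ J \<bullet> snd x + \<theta> $ Inr J)\<bar>)
        \<le> 2 * E" by simp
    moreover have "G_grad c \<theta> x $ Inl (I, J)
        = - 2 * (fst x $ I - network c \<theta> (snd x) $ I) * relu (c $ J \<bullet> snd x + \<theta> $ Inr J)"
      unfolding G_grad_def by simp
    ultimately show "\<bar>G_grad c \<theta> x $ Inl (I, J)\<bar> \<le> 2 * E"
      by (simp only: abs_mult)
  next
    fix J
    have "\<bar>\<Sum>i\<in>UNIV. (fst x $ i - network c \<theta> (snd x) $ i) * \<theta> $ Inl (i, J)
          * indicator (active_set c \<theta> J) (snd x)\<bar> \<le> (\<Sum>i\<in>(UNIV::'i set). E)"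
    proof (rule order_trans[OF sum_abs], rule sum_mono)
      fix i :: 'i
      have "\<bar>fst x $ i - network c \<theta> (snd x) $ i\<bar> * \<bar>\<theta> $ Inl (i, J)\<bar>
          * \<bar>indicator (active_set c \<theta> J) (snd x)\<bar> \<le> 2 * D * P * R * T\<^sup>2 * T * 1"
        using D P R T by (intro mult_mono e w) (auto simp: indicator_def)
      then show "\<bar>(fst x $ i - network c \<theta> (snd x) $ i) * \<theta> $ Inl (i, J)
          * indicator (active_set c \<theta> J) (snd x)\<bar> \<le> E"
        using b2 by (simp add: abs_mult)
    qed
    then show "\<bar>G_grad c \<theta> x $ Inr J\<bar> \<le> real CARD('i) * (2 * E)"
      unfolding G_grad_def by (simp add: abs_mult)
  qed
  also have "\<dots> = 8 * real CARD('i) * D\<^sup>2 * P\<^sup>2 * R\<^sup>2 * T ^ 4"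
    unfolding E_def D_def[symmetric] by (simp add: power2_eq_square D_def[symmetric])
  finally show ?thesis unfolding D_def P_def R_def T_def .
qed

text \<open>The pointwise increment of \<open>G\<close> splits into a Lipschitz part and the contribution of the jumps of
  the indicators. The \<open>i\<close>-th summand of the latter carries the weight \<open>1 + \<bar>y\<^sub>i\<bar> + \<bar>z\<bar>\<close>, with a single
  output coordinate, as the strip estimate requires.\<close>

lemma G_grad_diff_le:
  fixes c :: "real^'k::finite^'d::finite" and \<theta> \<theta>' :: "('i::finite, 'd) par"
  defines "S \<equiv> 1 + norm \<theta> + norm \<theta>'"
  shows "norm (G_grad c \<theta> x - G_grad c \<theta>' x)
    \<le> 16 * real CARD('i) * (real CARD('d))\<^sup>2 * (1 + norm c)\<^sup>2 * (1 + norm x)\<^sup>2 * S ^ 3 * norm (\<theta> - \<theta>')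
      + (\<Sum>J\<in>UNIV. \<Sum>i\<in>UNIV. 2 * real CARD('d) * (1 + norm c) * S ^ 3
          * ((1 + \<bar>fst x $ i\<bar> + norm (snd x))
            * indicator {min (- \<theta> $ Inr J) (- \<theta>' $ Inr J)..max (- \<theta> $ Inr J) (- \<theta>' $ Inr J)}
                (c $ J \<bullet> snd x)))"
proof -
  define D where "D = real CARD('d)"
  define P where "P = 1 + norm c"
  define R where "R = 1 + norm x"
  define \<delta> where "\<delta> = norm (\<theta> - \<theta>')"
  define K where "K = (\<lambda>J. indicator {min (- \<theta> $ Inr J) (- \<theta>' $ Inr J)..max (- \<theta> $ Inr J) (- \<theta>' $ Inr J)}
                (c $ J \<bullet> snd x) :: real)"
  define r where "r = (\<lambda>i. 1 + \<bar>fst x $ i\<bar> + norm (snd x))"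
  define e where "e = (\<lambda>(\<theta>::('i, 'd) par) i. fst x $ i - network c \<theta> (snd x) $ i)"
  define s where "s = (\<lambda>(\<theta>::('i, 'd) par) J. relu (c $ J \<bullet> snd x + \<theta> $ Inr J))"
  define a where "a = (\<lambda>(\<theta>::('i, 'd) par) J. indicator (active_set c \<theta> J) (snd x) :: real)"
  have D: "1 \<le> D" unfolding D_def by (simp add: Suc_leI)
  have P: "1 \<le> P" and R: "1 \<le> R" and S: "1 \<le> S" and \<delta>: "0 \<le> \<delta>"
    unfolding P_def R_def S_def \<delta>_def by auto
  have r0: "0 \<le> r i" for i unfolding r_def by auto
  have r: "r i \<le> 2 * R" for i unfolding r_def R_def by (rule one_plus_data_le)
  have z: "1 + norm (snd x) \<le> R" using norm_snd_le[of "snd x" "fst x"] unfolding R_def by simp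
  define E where "E = D * P\<^sup>2 * R\<^sup>2 * S ^ 3 * \<delta>"
  have de: "\<bar>e \<theta> i - e \<theta>' i\<bar> \<le> 2 * D * P * R * S * \<delta>" for i
  proof -
    have "2 * D * P * (1 + norm (snd x)) * S * \<delta> \<le> 2 * D * P * R * S * \<delta>"
      using D P S \<delta> z by (intro mult_right_mono mult_left_mono) auto
    then show ?thesis
      using network_lipschitz[of c \<theta> "snd x" i \<theta>'] unfolding e_def D_def P_def S_def \<delta>_def
      by linarith
  qed
  have e': "\<bar>e \<theta>' i\<bar> \<le> D * P * r i * S\<^sup>2" for i
  proof -
    have "D * P * r i * (1 + norm \<theta>')\<^sup>2 \<le> D * P * r i * S\<^sup>2"
      using D P r0 unfolding S_def by (intro mult_left_mono power_mono) auto
    then show ?thesis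
      using residual_bound[of "fst x $ i" c \<theta>' "snd x" i] unfolding e_def D_def P_def r_def by linarith
  qed
  have e'': "\<bar>e \<theta>' i\<bar> \<le> D * P * (2 * R) * S\<^sup>2" for i
  proof -
    have "D * P * r i * S\<^sup>2 \<le> D * P * (2 * R) * S\<^sup>2"
      using D P r by (intro mult_right_mono mult_left_mono) auto
    then show ?thesis using e'[of i] by simp
  qed
  have s: "\<bar>s \<theta> J\<bar> \<le> P * R * S" for J
  proof -
    have "P * (1 + norm (snd x)) * (1 + norm \<theta>) \<le> P * R * S"
      using P R S z unfolding S_def by (intro mult_mono) auto
    then show ?thesis using activation_bound[of c J "snd x" \<theta>] unfolding s_def P_def by linarith
  qed
  have ds: "\<bar>s \<theta> J - s \<theta>' J\<bar> \<le> \<delta>" for J unfolding s_def \<delta>_def by (rule activation_lipschitz)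
  have w: "\<bar>\<theta> $ l\<bar> \<le> S" "\<bar>\<theta>' $ l\<bar> \<le> S" "\<bar>\<theta> $ l - \<theta>' $ l\<bar> \<le> \<delta>" for l
    using component_le_norm_cart[of \<theta> l] component_le_norm_cart[of \<theta>' l]
      component_le_norm_cart[of "\<theta> - \<theta>'" l] norm_ge_zero[of \<theta>] norm_ge_zero[of \<theta>']
    unfolding S_def \<delta>_def by (simp_all del: norm_ge_zero)
  \<comment> \<open>The indicator jumps only if \<open>c\<^sub>J \<bullet> z\<close> lies between the two negated biases.\<close>
  have a: "\<bar>a \<theta> J\<bar> \<le> 1" "\<bar>a \<theta> J - a \<theta>' J\<bar> \<le> K J" for J
    unfolding a_def K_def by (auto simp: indicator_def active_set_def)
  have b1: "2 * D * P * R * S * \<delta> * (P * R * S) \<le> 2 * E"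
  proof -
    have "2 * D * P * R * S * \<delta> * (P * R * S) = 2 * (D * P\<^sup>2 * R\<^sup>2 * S\<^sup>2 * \<delta>)"
      by (simp add: power2_eq_square)
    also have "\<dots> \<le> 2 * E" unfolding E_def using D P R S \<delta>
      by (intro mult_left_mono mult_right_mono power_increasing) auto
    finally show ?thesis .
  qed
  have b2: "D * P * R * S\<^sup>2 * \<delta> \<le> E"
  proof -
    have "D * P ^ 1 * R ^ 1 * S\<^sup>2 * \<delta> \<le> E"
      unfolding E_def using D P R S \<delta> by (intro mult_mono power_increasing) auto
    then show ?thesis by simp
  qed
  have "norm (G_grad c \<theta> x - G_grad c \<theta>' x)
      \<le> real CARD('i) * real CARD('d) * (8 * E)
        + (\<Sum>J\<in>UNIV. \<Sum>i\<in>UNIV. 8 * E + 2 * D * P * S ^ 3 * (r i * K J))"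
  proof (rule norm_par_le)
    fix I J
    have "e \<theta> I * s \<theta> J - e \<theta>' I * s \<theta>' J = (e \<theta> I - e \<theta>' I) * s \<theta> J + e \<theta>' I * (s \<theta> J - s \<theta>' J)"
      by (simp add: algebra_simps)
    moreover have "\<bar>(e \<theta> I - e \<theta>' I) * s \<theta> J\<bar> \<le> 2 * D * P * R * S * \<delta> * (P * R * S)"
      unfolding abs_mult using D P R S \<delta> by (intro mult_mono de s) auto
    moreover have "\<bar>e \<theta>' I * (s \<theta> J - s \<theta>' J)\<bar> \<le> D * P * (2 * R) * S\<^sup>2 * \<delta>"
      unfolding abs_mult using D P R S \<delta> by (intro mult_mono e'' ds) auto
    ultimately have "\<bar>e \<theta> I * s \<theta> J - e \<theta>' I * s \<theta>' J\<bar> \<le> 4 * E"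
      using b1 b2 by linarith
    moreover have "(G_grad c \<theta> x - G_grad c \<theta>' x) $ Inl (I, J)
        = - 2 * (e \<theta> I * s \<theta> J - e \<theta>' I * s \<theta>' J)"
      unfolding G_grad_def e_def s_def by (simp add: algebra_simps)
    ultimately show "\<bar>(G_grad c \<theta> x - G_grad c \<theta>' x) $ Inl (I, J)\<bar> \<le> 8 * E"
      by (simp add: abs_mult)
  next
    fix J
    let ?g = "\<lambda>\<theta> i. e \<theta> i * \<theta> $ Inl (i, J) * a \<theta> J"
    have "\<bar>\<Sum>i\<in>UNIV. ?g \<theta> i - ?g \<theta>' i\<bar> \<le> (\<Sum>i\<in>UNIV. 4 * E + D * P * S ^ 3 * (r i * K J))"
    proof (rule order_trans[OF sum_abs], rule sum_mono)
      fix i :: 'i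
      let ?w = "\<lambda>\<theta>::('i, 'd) par. \<theta> $ Inl (i, J)"
      have "?g \<theta> i - ?g \<theta>' i = (e \<theta> i - e \<theta>' i) * ?w \<theta> * a \<theta> J
          + e \<theta>' i * (?w \<theta> - ?w \<theta>') * a \<theta> J + e \<theta>' i * ?w \<theta>' * (a \<theta> J - a \<theta>' J)"
        by (simp add: algebra_simps)
      moreover have "\<bar>(e \<theta> i - e \<theta>' i) * ?w \<theta> * a \<theta> J\<bar> \<le> 2 * D * P * R * S * \<delta> * S * 1"
        unfolding abs_mult using D P R S \<delta> by (intro mult_mono de w a) auto
      moreover have "\<bar>e \<theta>' i * (?w \<theta> - ?w \<theta>') * a \<theta> J\<bar> \<le> D * P * (2 * R) * S\<^sup>2 * \<delta> * 1"
        unfolding abs_mult using D P R S \<delta> by (intro mult_mono e'' w a) auto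
      moreover have "\<bar>e \<theta>' i * ?w \<theta>' * (a \<theta> J - a \<theta>' J)\<bar> \<le> D * P * r i * S\<^sup>2 * S * K J"
        unfolding abs_mult using D P R S \<delta> r0 by (intro mult_mono e' w a) auto
      moreover have "D * P * r i * S\<^sup>2 * S * K J = D * P * S ^ 3 * (r i * K J)"
        by (simp add: power2_eq_square power3_eq_cube)
      moreover have "2 * D * P * R * S * \<delta> * S * 1 = 2 * (D * P * R * S\<^sup>2 * \<delta>)"
        by (simp add: power2_eq_square)
      ultimately show "\<bar>?g \<theta> i - ?g \<theta>' i\<bar> \<le> 4 * E + D * P * S ^ 3 * (r i * K J)"
        using b2 by linarith
    qed
    moreover have "(G_grad c \<theta> x - G_grad c \<theta>' x) $ Inr J = - 2 * (\<Sum>i\<in>UNIV. ?g \<theta> i - ?g \<theta>' i)"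
      unfolding G_grad_def e_def a_def by (simp add: sum_subtractf)
    ultimately have "\<bar>(G_grad c \<theta> x - G_grad c \<theta>' x) $ Inr J\<bar>
        \<le> 2 * (\<Sum>i\<in>UNIV. 4 * E + D * P * S ^ 3 * (r i * K J))"
      by (simp only: abs_mult)
    also have "\<dots> = (\<Sum>i\<in>UNIV. 8 * E + 2 * D * P * S ^ 3 * (r i * K J))"
      by (simp add: sum_distrib_left algebra_simps)
    finally show "\<bar>(G_grad c \<theta> x - G_grad c \<theta>' x) $ Inr J\<bar>
        \<le> (\<Sum>i\<in>UNIV. 8 * E + 2 * D * P * S ^ 3 * (r i * K J))" .
  qed
  also have "\<dots> = 16 * real CARD('i) * D\<^sup>2 * P\<^sup>2 * R\<^sup>2 * S ^ 3 * \<delta>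
      + (\<Sum>J\<in>UNIV. \<Sum>i\<in>UNIV. 2 * D * P * S ^ 3 * (r i * K J))"
    by (simp add: sum.distrib E_def D_def[symmetric] power2_eq_square)
  finally show ?thesis unfolding D_def P_def R_def \<delta>_def K_def r_def .
qed

lemma squared_residual_lipschitz:
  fixes c :: "real^'k::finite^'d::finite" and \<theta> \<theta>' :: "('i::finite, 'd) par"
  shows "\<bar>(norm (fst x - network c \<theta> (snd x)))\<^sup>2 - (norm (fst x - network c \<theta>' (snd x)))\<^sup>2\<bar>
    \<le> 8 * real CARD('i) * (real CARD('d))\<^sup>2 * (1 + norm c)\<^sup>2 * (1 + norm x)\<^sup>2
      * (1 + norm \<theta> + norm \<theta>') ^ 3 * norm (\<theta> - \<theta>')"
proof -
  define D where "D = real CARD('d)"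
  define P where "P = 1 + norm c"
  define R where "R = 1 + norm x"
  define S where "S = 1 + norm \<theta> + norm \<theta>'"
  define \<delta> where "\<delta> = norm (\<theta> - \<theta>')"
  define e where "e = (\<lambda>(\<theta>::('i, 'd) par) i. fst x $ i - network c \<theta> (snd x) $ i)"
  have D: "1 \<le> D" unfolding D_def by (simp add: Suc_leI)
  have P: "1 \<le> P" and R: "1 \<le> R" and S: "1 \<le> S" and \<delta>: "0 \<le> \<delta>"
    unfolding P_def R_def S_def \<delta>_def by auto
  have z: "1 + norm (snd x) \<le> R" using norm_snd_le[of "snd x" "fst x"] unfolding R_def by simp
  have de: "\<bar>e \<theta> i - e \<theta>' i\<bar> \<le> 2 * D * P * R * S * \<delta>" for i
  proof -
    have "2 * D * P * (1 + norm (snd x)) * S * \<delta> \<le> 2 * D * P * R * S * \<delta>"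
      using D P S \<delta> z by (intro mult_right_mono mult_left_mono) auto
    then show ?thesis
      using network_lipschitz[of c \<theta> "snd x" i \<theta>'] unfolding e_def D_def P_def S_def \<delta>_def
      by linarith
  qed
  have e: "\<bar>e \<theta>'' i\<bar> \<le> D * P * (2 * R) * S\<^sup>2" if "1 + norm \<theta>'' \<le> S" for \<theta>'' i
  proof -
    have "D * P * (1 + \<bar>fst x $ i\<bar> + norm (snd x)) * (1 + norm \<theta>'')\<^sup>2 \<le> D * P * (2 * R) * S\<^sup>2"
      using D P R that one_plus_data_le[of x i] unfolding R_def by (intro mult_mono power_mono) auto
    then show ?thesis
      using residual_bound[of "fst x $ i" c \<theta>'' "snd x" i] unfolding e_def D_def P_def by linarith
  qed
  have "(norm (fst x - network c \<theta> (snd x)))\<^sup>2 - (norm (fst x - network c \<theta>' (snd x)))\<^sup>2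
      = (\<Sum>i\<in>UNIV. (e \<theta> i)\<^sup>2 - (e \<theta>' i)\<^sup>2)"
    by (simp add: norm_vec_def L2_set_def sum_nonneg sum_subtractf e_def)
  moreover have "\<bar>\<Sum>i\<in>UNIV. (e \<theta> i)\<^sup>2 - (e \<theta>' i)\<^sup>2\<bar>
      \<le> (\<Sum>i\<in>(UNIV::'i set). 2 * D * P * R * S * \<delta> * (2 * (D * P * (2 * R) * S\<^sup>2)))"
  proof (rule order_trans[OF sum_abs], rule sum_mono)
    fix i :: 'i
    have "\<bar>e \<theta> i + e \<theta>' i\<bar> \<le> 2 * (D * P * (2 * R) * S\<^sup>2)"
      using e[of \<theta> i] e[of \<theta>' i] unfolding S_def by simp
    then have "\<bar>e \<theta> i - e \<theta>' i\<bar> * \<bar>e \<theta> i + e \<theta>' i\<bar>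
        \<le> 2 * D * P * R * S * \<delta> * (2 * (D * P * (2 * R) * S\<^sup>2))"
      using D P R S \<delta> by (intro mult_mono de) auto
    moreover have "(e \<theta> i)\<^sup>2 - (e \<theta>' i)\<^sup>2 = (e \<theta> i - e \<theta>' i) * (e \<theta> i + e \<theta>' i)"
      by (simp add: power2_eq_square algebra_simps)
    ultimately show "\<bar>(e \<theta> i)\<^sup>2 - (e \<theta>' i)\<^sup>2\<bar>
        \<le> 2 * D * P * R * S * \<delta> * (2 * (D * P * (2 * R) * S\<^sup>2))"
      by (simp add: abs_mult)
  qed
  moreover have "(\<Sum>i\<in>(UNIV::'i set). 2 * D * P * R * S * \<delta> * (2 * (D * P * (2 * R) * S\<^sup>2)))
      = 8 * real CARD('i) * D\<^sup>2 * P\<^sup>2 * R\<^sup>2 * S ^ 3 * \<delta>"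
    by (simp add: power2_eq_square power3_eq_cube)
  ultimately have "\<bar>(norm (fst x - network c \<theta> (snd x)))\<^sup>2 - (norm (fst x - network c \<theta>' (snd x)))\<^sup>2\<bar>
      \<le> 8 * real CARD('i) * D\<^sup>2 * P\<^sup>2 * R\<^sup>2 * S ^ 3 * \<delta>"
    by (simp only:)
  then show ?thesis unfolding D_def P_def R_def S_def \<delta>_def .
qed

section \<open>Conditional densities and strips\<close>

text \<open>The defining identity of a conditional density is a statement about measurable rectangles. Since
  these form a generator stable under intersection, the joint law of \<open>(U, W)\<close> has density \<open>f\<close> with
  respect to the product of Lebesgue measure and the law of \<open>W\<close>.\<close>

lemma conditional_density_nn_integral:
  assumes "prob_space M" and cd: "conditional_density M S U W f"
    and h[measurable]: "h \<in> borel_measurable (borel \<Otimes>\<^sub>M S)"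
  shows "(\<integral>\<^sup>+\<omega>. h (U \<omega>, W \<omega>) \<partial>M)
    = (\<integral>\<^sup>+w. (\<integral>\<^sup>+u. ennreal (f u w) * h (u, w) \<partial>lborel) \<partial>distr M S W)"
proof -
  interpret prob_space M by fact
  have U[measurable]: "U \<in> borel_measurable M" and W[measurable]: "W \<in> measurable M S"
    and f[measurable]: "(\<lambda>(u, w). f u w) \<in> borel_measurable (borel \<Otimes>\<^sub>M S)"
    and rect: "\<And>A B. A \<in> sets borel \<Longrightarrow> B \<in> sets S \<Longrightarrow>
        emeasure M {\<omega>\<in>space M. U \<omega> \<in> A \<and> W \<omega> \<in> B}
          = (\<integral>\<^sup>+w\<in>B. (\<integral>\<^sup>+u\<in>A. ennreal (f u w) \<partial>lborel) \<partial>distr M S W)"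
    using cd unfolding conditional_density_def by auto
  define Q where "Q = distr M S W"
  interpret Q: prob_space Q unfolding Q_def by (rule prob_space_distr) simp
  interpret LQ: pair_sigma_finite lborel Q ..
  have [measurable_cong]: "sets Q = sets S" unfolding Q_def by simp
  have f': "(\<lambda>p. ennreal (f (fst p) (snd p))) \<in> borel_measurable (lborel \<Otimes>\<^sub>M Q)"
    using f by (simp add: split_beta' cong: measurable_cong_sets)
  note f'[measurable]
  define N where "N = density (lborel \<Otimes>\<^sub>M Q) (\<lambda>p. ennreal (f (fst p) (snd p)))"
  have eq: "distr M (borel \<Otimes>\<^sub>M S) (\<lambda>\<omega>. (U \<omega>, W \<omega>)) = N" (is "?D = N")
  proof (rule measure_eqI_generator_eq[OF Int_stable_pair_measure_generator[of borel S]])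
    show "{a \<times> b |a b. a \<in> sets borel \<and> b \<in> sets S} \<subseteq> Pow (space borel \<times> space S)"
      using sets.sets_into_space by fastforce
    show "sets ?D = sigma_sets (space borel \<times> space S) {a \<times> b |a b. a \<in> sets borel \<and> b \<in> sets S}"
      by (simp add: sets_pair_measure)
    show "sets N = sigma_sets (space borel \<times> space S) {a \<times> b |a b. a \<in> sets borel \<and> b \<in> sets S}"
      unfolding N_def by (simp add: sets_pair_measure Q_def)
    show "range (\<lambda>_::nat. space (borel::real measure) \<times> space S) \<subseteq> {a \<times> b |a b. a \<in> sets (borel :: real measure) \<and> b \<in> sets S}"
      by blast
    show "(\<Union>i::nat. space (borel::real measure) \<times> space S) = space borel \<times> space S" by simp
    interpret D: prob_space ?D by (rule prob_space_distr) simp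
    show "emeasure ?D (space borel \<times> space S) \<noteq> \<infinity>" for i :: nat
      using D.emeasure_finite by (simp add: infinity_ennreal_def)
    fix R :: "(real \<times> 'b) set" assume "R \<in> {a \<times> b |a b. a \<in> sets borel \<and> b \<in> sets S}"
    then obtain A B where R: "R = A \<times> B" and AB[measurable]: "A \<in> sets borel" "B \<in> sets S" by auto
    have "emeasure ?D R = emeasure M {\<omega>\<in>space M. U \<omega> \<in> A \<and> W \<omega> \<in> B}"
      unfolding R by (subst emeasure_distr) (auto intro!: arg_cong[where f="emeasure M"])
    also have "\<dots> = (\<integral>\<^sup>+w. (\<integral>\<^sup>+u. ennreal (f u w) * indicator R (u, w) \<partial>lborel) \<partial>Q)"
    proof -
      have "(\<integral>\<^sup>+u\<in>A. ennreal (f u w) \<partial>lborel) * indicator B w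
          = (\<integral>\<^sup>+u. ennreal (f u w) * indicator R (u, w) \<partial>lborel)" for w
        by (simp add: R indicator_times split: split_indicator)
      then show ?thesis by (simp add: rect AB Q_def)
    qed
    also have "\<dots> = (\<integral>\<^sup>+p. ennreal (f (fst p) (snd p)) * indicator R p \<partial>(lborel \<Otimes>\<^sub>M Q))"
      by (subst LQ.nn_integral_snd[symmetric]) (auto simp: R)
    also have "\<dots> = emeasure N R"
      unfolding N_def by (subst emeasure_density) (auto simp: R)
    finally show "emeasure ?D R = emeasure N R" .
  qed
  have "(\<integral>\<^sup>+\<omega>. h (U \<omega>, W \<omega>) \<partial>M) = (\<integral>\<^sup>+p. h p \<partial>?D)"
    by (subst nn_integral_distr) auto
  also have "\<dots> = (\<integral>\<^sup>+p. ennreal (f (fst p) (snd p)) * h p \<partial>(lborel \<Otimes>\<^sub>M Q))"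
    unfolding eq N_def by (subst nn_integral_density) auto
  also have "\<dots> = (\<integral>\<^sup>+w. (\<integral>\<^sup>+u. ennreal (f u w) * h (u, w) \<partial>lborel) \<partial>Q)"
    by (subst LQ.nn_integral_snd[symmetric]) auto
  finally show ?thesis unfolding Q_def .
qed

lemma emeasure_strip:
  fixes \<kappa> :: real
  assumes "\<kappa> \<noteq> 0" "p \<le> q"
  shows "emeasure lborel {u. p \<le> \<kappa> * u + t \<and> \<kappa> * u + t \<le> q} = ennreal ((q - p) / \<bar>\<kappa>\<bar>)"
proof (cases "\<kappa> > 0")
  case True
  then have "{u. p \<le> \<kappa> * u + t \<and> \<kappa> * u + t \<le> q} = {(p - t) / \<kappa>..(q - t) / \<kappa>}"
    by (auto simp: field_simps)
  then show ?thesis using True assms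
    by (simp add: divide_right_mono diff_divide_distrib)
next
  case False
  then have "{u. p \<le> \<kappa> * u + t \<and> \<kappa> * u + t \<le> q} = {(q - t) / \<kappa>..(p - t) / \<kappa>}"
    using assms by (auto simp: field_simps)
  moreover have "(q - t) / \<kappa> \<le> (p - t) / \<kappa>" using False assms by (simp add: divide_right_mono_neg)
  moreover have "(p - t) / \<kappa> - (q - t) / \<kappa> = (q - p) / \<bar>\<kappa>\<bar>"
    using False assms by (simp add: field_simps)
  ultimately show ?thesis by simp
qed

text \<open>The anti-concentration estimate. Given \<open>W = w\<close>, the event confines \<open>U\<close> to an interval of length
  \<open>(q - p) / \<bar>\<kappa>\<bar>\<close>. On this interval \<open>f \<le> C\<close> controls the part \<open>g w\<close> of the weight that does not
  depend on \<open>U\<close>, and \<open>\<bar>u\<bar> f \<le> (1 + u\<^sup>2) f / 2 \<le> (C + Cb) / 2\<close> controls the linear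
  growth in \<open>U\<close>.\<close>

lemma strip_nn_integral_le:
  assumes "prob_space M" and cd: "conditional_density M S U W f"
    and C: "\<And>u w. w \<in> space S \<Longrightarrow> f u w \<le> C"
    and Cb: "\<And>u w. w \<in> space S \<Longrightarrow> u\<^sup>2 * f u w \<le> Cb"
    and g[measurable]: "g \<in> borel_measurable S" and g0: "\<And>w. 0 \<le> g w"
    and s[measurable]: "s \<in> borel_measurable S"
    and \<kappa>: "\<kappa> \<noteq> 0" and pq: "p \<le> q"
  shows "(\<integral>\<^sup>+\<omega>. ennreal ((g (W \<omega>) + \<bar>U \<omega>\<bar>) * indicator {p..q} (\<kappa> * U \<omega> + s (W \<omega>))) \<partial>M)
    \<le> ennreal ((q - p) / \<bar>\<kappa>\<bar>) * (\<integral>\<^sup>+\<omega>. ennreal (C * g (W \<omega>) + (C + Cb) / 2) \<partial>M)"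
proof -
  interpret prob_space M by fact
  have W[measurable]: "W \<in> measurable M S" and f0: "\<And>u w. w \<in> space S \<Longrightarrow> 0 \<le> f u w"
    using cd unfolding conditional_density_def by auto
  let ?h = "\<lambda>(u, w). ennreal ((g w + \<bar>u\<bar>) * indicator {p..q} (\<kappa> * u + s w))"
  have "(\<integral>\<^sup>+\<omega>. ?h (U \<omega>, W \<omega>) \<partial>M)
      = (\<integral>\<^sup>+w. (\<integral>\<^sup>+u. ennreal (f u w) * ?h (u, w) \<partial>lborel) \<partial>distr M S W)"
    by (rule conditional_density_nn_integral[OF assms(1) cd]) simp
  also have "\<dots> \<le> (\<integral>\<^sup>+w. ennreal (C * g w + (C + Cb) / 2) * ennreal ((q - p) / \<bar>\<kappa>\<bar>) \<partial>distr M S W)"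
  proof (rule nn_integral_mono)
    fix w assume "w \<in> space (distr M S W)"
    then have w: "w \<in> space S" by simp
    let ?T = "{u. p \<le> \<kappa> * u + s w \<and> \<kappa> * u + s w \<le> q}"
    have "ennreal (f u w) * ?h (u, w) \<le> ennreal (C * g w + (C + Cb) / 2) * indicator ?T u" for u
    proof (cases "u \<in> ?T")
      case True
      have "2 * \<bar>u\<bar> \<le> 1 + u\<^sup>2"
        using zero_le_power2[of "\<bar>u\<bar> - 1"] by (simp add: power2_diff)
      then have "f u w * (2 * \<bar>u\<bar>) \<le> f u w * (1 + u\<^sup>2)"
        by (intro mult_left_mono f0 w)
      then have "f u w * \<bar>u\<bar> \<le> (C + Cb) / 2"
        using C[OF w, of u] Cb[OF w, of u] unfolding distrib_left by (simp add: mult_ac)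
      moreover have "f u w * g w \<le> C * g w"
        by (intro mult_right_mono C w g0)
      ultimately have "f u w * (g w + \<bar>u\<bar>) \<le> C * g w + (C + Cb) / 2"
        unfolding distrib_left by linarith
      then show ?thesis using True f0[OF w, of u]
        by (simp add: ennreal_mult'[symmetric] ennreal_leI)
    qed auto
    then have "(\<integral>\<^sup>+u. ennreal (f u w) * ?h (u, w) \<partial>lborel)
        \<le> (\<integral>\<^sup>+u. ennreal (C * g w + (C + Cb) / 2) * indicator ?T u \<partial>lborel)"
      by (rule nn_integral_mono)
    also have "\<dots> = ennreal (C * g w + (C + Cb) / 2) * ennreal ((q - p) / \<bar>\<kappa>\<bar>)"
      by (subst nn_integral_cmult_indicator) (simp_all add: emeasure_strip \<kappa> pq)
    finally show "(\<integral>\<^sup>+u. ennreal (f u w) * ?h (u, w) \<partial>lborel)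
        \<le> ennreal (C * g w + (C + Cb) / 2) * ennreal ((q - p) / \<bar>\<kappa>\<bar>)" .
  qed
  also have "\<dots> = ennreal ((q - p) / \<bar>\<kappa>\<bar>) * (\<integral>\<^sup>+\<omega>. ennreal (C * g (W \<omega>) + (C + Cb) / 2) \<partial>M)"
    by (subst nn_integral_distr) (auto simp: nn_integral_multc mult.commute[of "ennreal ((q - p) / _)"])
  finally show ?thesis by simp
qed

text \<open>The strip estimate for the data: \<open>U\<close> is the coordinate \<open>Z\<^sub>K\<close> and \<open>W\<close> consists of the remaining
  coordinates of \<open>Z\<close> together with a single output coordinate \<open>Y\<^sub>I\<close>. The hypothesis on the conditional
  densities involves only one output coordinate at a time, so the weight must not contain the other
  coordinates of \<open>Y\<close>. For \<open>p = q\<close> the strip is a hyperplane, which the law of \<open>Z\<close> therefore does not charge.\<close>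

lemma
  fixes X :: "'a \<Rightarrow> ('i::finite, 'k::finite) dat" and v :: "real^'k"
  assumes "prob_space M" and X[measurable]: "X \<in> borel_measurable M"
    and int: "integrable M (\<lambda>\<omega>. norm (X \<omega>))"
    and cd: "conditional_density M (Pi\<^sub>M (- {K}) (\<lambda>_. borel) \<Otimes>\<^sub>M borel)
        (\<lambda>\<omega>. snd (X \<omega>) $ K) (\<lambda>\<omega>. (drop_coord K (snd (X \<omega>)), fst (X \<omega>) $ I)) f"
    and C0: "0 \<le> C" "0 \<le> Cb"
    and C: "\<And>(z :: real^'k) y. f (z $ K) (drop_coord K z, y) \<le> C"
    and Cb: "\<And>(z :: real^'k) y. \<bar>z $ K\<bar>\<^sup>2 * f (z $ K) (drop_coord K z, y) \<le> Cb"
    and v: "v $ K \<noteq> 0"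
  shows strip_expectation_le: "p \<le> q \<Longrightarrow>
      (\<integral>\<omega>. (1 + \<bar>fst (X \<omega>) $ I\<bar> + norm (snd (X \<omega>))) * indicator {p..q} (v \<bullet> snd (X \<omega>)) \<partial>M)
        \<le> 2 * ((C + Cb) / \<bar>v $ K\<bar>) * (q - p) * (\<integral>\<omega>. 1 + norm (X \<omega>) \<partial>M)"
    and hyperplane_null: "AE \<omega> in M. v \<bullet> snd (X \<omega>) \<noteq> p"
proof -
  interpret prob_space M by fact
  define S :: "(('k \<Rightarrow> real) \<times> real) measure" where "S = Pi\<^sub>M (- {K}) (\<lambda>_. borel) \<Otimes>\<^sub>M borel"
  define U where "U = (\<lambda>\<omega>. snd (X \<omega>) $ K)"
  define W where "W = (\<lambda>\<omega>. (drop_coord K (snd (X \<omega>)), fst (X \<omega>) $ I))"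
  define g :: "('k \<Rightarrow> real) \<times> real \<Rightarrow> real"
    where "g = (\<lambda>w. 1 + \<bar>snd w\<bar> + L2_set (fst w) (- {K}))"
  define s :: "('k \<Rightarrow> real) \<times> real \<Rightarrow> real" where "s = (\<lambda>w. \<Sum>k\<in>- {K}. v $ k * fst w k)"
  define t where "t = (\<lambda>\<omega>. 1 + \<bar>fst (X \<omega>) $ I\<bar> + norm (snd (X \<omega>)))"
  have [measurable]: "(\<lambda>\<omega>. fst (X \<omega>)) \<in> borel_measurable M" "(\<lambda>\<omega>. snd (X \<omega>)) \<in> borel_measurable M"
    by (auto intro!: measurable_compose[OF X] borel_measurable_continuous_onI continuous_intros)
  have [measurable]: "(\<lambda>x::real^'i. x $ I) \<in> borel_measurable borel"
    by (intro borel_measurable_continuous_onI continuous_intros)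
  have t_meas[measurable]: "t \<in> borel_measurable M"
    unfolding t_def by measurable
  have comp[measurable]: "(\<lambda>w. fst w k) \<in> borel_measurable S" if "k \<in> - {K}" for k
    unfolding S_def using that by measurable
  have g_meas: "g \<in> borel_measurable S"
  proof -
    have [measurable]: "snd \<in> borel_measurable S" unfolding S_def by measurable
    show ?thesis unfolding g_def L2_set_def by measurable
  qed
  have s_meas: "s \<in> borel_measurable S" unfolding s_def by measurable
  have g0: "0 \<le> g w" for w unfolding g_def by (simp add: L2_set_nonneg)
  \<comment> \<open>The bounds on \<open>f\<close> are given along \<open>drop_coord\<close>; every point of the conditioning space arises
    from it, with an arbitrary value of the dropped coordinate.\<close>
  have split: "\<exists>z y. w = (drop_coord K z, y) \<and> (z :: real^'k) $ K = u" if "w \<in> space S" for w u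
  proof -
    define z where "z = ((\<chi> k. if k = K then u else fst w k) :: real^'k)"
    have w: "fst w \<in> (\<Pi>\<^sub>E k\<in>- {K}. UNIV)"
      using that unfolding S_def by (simp add: space_pair_measure space_PiM mem_Times_iff)
    have "drop_coord K z k = fst w k" for k
      using w unfolding drop_coord_def z_def by (auto simp: PiE_def extensional_def)
    then have "drop_coord K z = fst w" by (rule ext)
    then have "w = (drop_coord K z, snd w) \<and> z $ K = u" by (simp add: z_def)
    then show ?thesis by blast
  qed
  have inner: "v \<bullet> snd (X \<omega>) = v $ K * U \<omega> + s (W \<omega>)" for \<omega>
    unfolding inner_vec_def U_def W_def s_def drop_coord_def
    by (subst sum.remove[of UNIV K]) (auto simp: Compl_eq_Diff_UNIV intro!: sum.cong)
  have norm_z: "norm (snd (X \<omega>)) \<le> \<bar>U \<omega>\<bar> + L2_set (fst (W \<omega>)) (- {K})" for \<omega>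
  proof -
    have "norm (snd (X \<omega>)) = L2_set (\<lambda>k. snd (X \<omega>) $ k) (insert K (- {K}))"
      unfolding norm_vec_def by (simp add: L2_set_def insert_UNIV Compl_eq_Diff_UNIV insert_absorb)
    also have "\<dots> = sqrt ((U \<omega>)\<^sup>2 + (L2_set (\<lambda>k. snd (X \<omega>) $ k) (- {K}))\<^sup>2)"
      by (subst L2_set_insert) (auto simp: U_def)
    also have "L2_set (\<lambda>k. snd (X \<omega>) $ k) (- {K}) = L2_set (fst (W \<omega>)) (- {K})"
      unfolding W_def drop_coord_def by (intro L2_set_cong) auto
    finally show ?thesis
      using sqrt_sum_squares_le_sum_abs[of "U \<omega>" "L2_set (fst (W \<omega>)) (- {K})"]
      by (simp add: L2_set_nonneg)
  qed
  have L2_le: "L2_set (fst (W \<omega>)) (- {K}) \<le> norm (X \<omega>)" for \<omega>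
  proof -
    have "L2_set (fst (W \<omega>)) (- {K}) = L2_set (\<lambda>k. snd (X \<omega>) $ k) (- {K})"
      unfolding W_def drop_coord_def by (intro L2_set_cong) auto
    also have "\<dots> \<le> norm (snd (X \<omega>))"
      unfolding norm_vec_def L2_set_def by (auto intro!: sum_mono2)
    also have "\<dots> \<le> norm (X \<omega>)" using norm_snd_le[of "snd (X \<omega>)" "fst (X \<omega>)"] by simp
    finally show ?thesis .
  qed
  have Y_le: "\<bar>fst (X \<omega>) $ I\<bar> \<le> norm (X \<omega>)" for \<omega>
    using component_le_norm_cart[of "fst (X \<omega>)" I] norm_fst_le[of "fst (X \<omega>)" "snd (X \<omega>)"] by simp
  have bound: "(\<integral>\<^sup>+\<omega>. ennreal (t \<omega> * indicator {p..q} (v \<bullet> snd (X \<omega>))) \<partial>M)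
      \<le> ennreal (2 * ((C + Cb) / \<bar>v $ K\<bar>) * (q - p) * (\<integral>\<omega>. 1 + norm (X \<omega>) \<partial>M))"
    if pq: "p \<le> q" for p q
  proof -
    have "(\<integral>\<^sup>+\<omega>. ennreal (t \<omega> * indicator {p..q} (v \<bullet> snd (X \<omega>))) \<partial>M)
        \<le> (\<integral>\<^sup>+\<omega>. ennreal ((g (W \<omega>) + \<bar>U \<omega>\<bar>) * indicator {p..q} (v $ K * U \<omega> + s (W \<omega>))) \<partial>M)"
      using norm_z
      by (intro nn_integral_mono ennreal_leI)
        (auto simp: inner t_def g_def W_def algebra_simps split: split_indicator)
    also have "\<dots> \<le> ennreal ((q - p) / \<bar>v $ K\<bar>) * (\<integral>\<^sup>+\<omega>. ennreal (C * g (W \<omega>) + (C + Cb) / 2) \<partial>M)"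
    proof (rule strip_nn_integral_le[OF \<open>prob_space M\<close> _ _ _ g_meas g0 s_meas v pq])
      show "conditional_density M S U W f" using cd unfolding S_def U_def W_def .
      show "f u w \<le> C" if "w \<in> space S" for u w
        using split[OF that, of u] C by auto
      show "u\<^sup>2 * f u w \<le> Cb" if "w \<in> space S" for u w
        using split[OF that, of u] Cb by (metis power2_abs)
    qed
    also have "\<dots> \<le> ennreal ((q - p) / \<bar>v $ K\<bar>)
        * (\<integral>\<^sup>+\<omega>. ennreal ((C + Cb) * 2 * (1 + norm (X \<omega>))) \<partial>M)"
    proof (intro mult_left_mono nn_integral_mono ennreal_leI)
      fix \<omega>
      have "g (W \<omega>) \<le> 1 + 2 * norm (X \<omega>)"
        using L2_le[of \<omega>] Y_le[of \<omega>] unfolding g_def by (simp add: W_def)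
      then have "C * g (W \<omega>) \<le> (C + Cb) * (1 + 2 * norm (X \<omega>))"
        using C0 g0 by (intro mult_mono) auto
      moreover have "(C + Cb) / 2 \<le> C + Cb" using C0 by simp
      ultimately have "C * g (W \<omega>) + (C + Cb) / 2 \<le> (C + Cb) * (1 + 2 * norm (X \<omega>)) + (C + Cb)"
        by (rule add_mono)
      also have "\<dots> = (C + Cb) * 2 * (1 + norm (X \<omega>))" by (simp add: algebra_simps)
      finally show "C * g (W \<omega>) + (C + Cb) / 2 \<le> (C + Cb) * 2 * (1 + norm (X \<omega>))" .
    qed auto
    also have "(\<integral>\<^sup>+\<omega>. ennreal ((C + Cb) * 2 * (1 + norm (X \<omega>))) \<partial>M)
        = ennreal ((C + Cb) * 2 * (\<integral>\<omega>. 1 + norm (X \<omega>) \<partial>M))"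
      using int C0 by (subst nn_integral_eq_integral) auto
    also have "ennreal ((q - p) / \<bar>v $ K\<bar>) * ennreal ((C + Cb) * 2 * (\<integral>\<omega>. 1 + norm (X \<omega>) \<partial>M))
        = ennreal (2 * ((C + Cb) / \<bar>v $ K\<bar>) * (q - p) * (\<integral>\<omega>. 1 + norm (X \<omega>) \<partial>M))"
      using pq by (subst ennreal_mult'[symmetric]) (auto simp: mult_ac)
    finally show ?thesis .
  qed
  have t0: "0 < t \<omega>" for \<omega> unfolding t_def by (smt (verit) norm_ge_zero)
  show "(\<integral>\<omega>. (1 + \<bar>fst (X \<omega>) $ I\<bar> + norm (snd (X \<omega>))) * indicator {p..q} (v \<bullet> snd (X \<omega>)) \<partial>M)
        \<le> 2 * ((C + Cb) / \<bar>v $ K\<bar>) * (q - p) * (\<integral>\<omega>. 1 + norm (X \<omega>) \<partial>M)" if pq: "p \<le> q"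
  proof -
    have "0 \<le> 2 * ((C + Cb) / \<bar>v $ K\<bar>) * (q - p) * (\<integral>\<omega>. 1 + norm (X \<omega>) \<partial>M)"
      using C0 pq by (intro mult_nonneg_nonneg integral_nonneg_AE) auto
    then have "(\<integral>\<omega>. t \<omega> * indicator {p..q} (v \<bullet> snd (X \<omega>)) \<partial>M)
        \<le> 2 * ((C + Cb) / \<bar>v $ K\<bar>) * (q - p) * (\<integral>\<omega>. 1 + norm (X \<omega>) \<partial>M)"
      by (rule integral_real_bounded[OF _ bound[OF pq]])
    then show ?thesis unfolding t_def .
  qed
  have "(\<integral>\<^sup>+\<omega>. ennreal (t \<omega> * indicator {p..p} (v \<bullet> snd (X \<omega>))) \<partial>M) = 0"
    using bound[of p p] by simp
  then have "AE \<omega> in M. ennreal (t \<omega> * indicator {p..p} (v \<bullet> snd (X \<omega>))) = 0"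
    by (subst (asm) nn_integral_0_iff_AE) auto
  then show "AE \<omega> in M. v \<bullet> snd (X \<omega>) \<noteq> p"
  proof (rule AE_mp, intro AE_I2 impI)
    fix \<omega> assume *: "ennreal (t \<omega> * indicator {p..p} (v \<bullet> snd (X \<omega>))) = 0"
    show "v \<bullet> snd (X \<omega>) \<noteq> p"
      using * t0[of \<omega>] by (auto simp: indicator_def ennreal_eq_0_iff)
  qed
qed

section \<open>Differentiability of the squared residual\<close>

text \<open>Differentiation under the integral sign at a fixed parameter \<open>\<theta>\<close>: almost every section need be
  differentiable only at \<open>\<theta>\<close>, provided that its difference quotients at \<open>\<theta>\<close> are dominated.\<close>

lemma GDERIV_integral:
  fixes \<phi> :: "'p::euclidean_space \<Rightarrow> 'a \<Rightarrow> real" and g :: "'a \<Rightarrow> 'p"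
  assumes \<phi>: "\<And>\<theta>. integrable M (\<phi> \<theta>)" and g: "integrable M g"
    and L: "integrable M L"
    and lip: "\<And>\<theta>' x. norm (\<theta>' - \<theta>) \<le> 1 \<Longrightarrow> x \<in> space M \<Longrightarrow>
        \<bar>\<phi> \<theta>' x - \<phi> \<theta> x\<bar> \<le> L x * norm (\<theta>' - \<theta>)"
    and ae: "AE x in M. GDERIV (\<lambda>\<theta>. \<phi> \<theta> x) \<theta> :> g x"
  shows "GDERIV (\<lambda>\<theta>. \<integral>x. \<phi> \<theta> x \<partial>M) \<theta> :> (\<integral>x. g x \<partial>M)"
proof -
  define e where "e = (\<lambda>\<theta>' x. (\<phi> \<theta>' x - \<phi> \<theta> x - (\<theta>' - \<theta>) \<bullet> g x) / norm (\<theta>' - \<theta>))"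
  have e_int: "integrable M (e \<theta>')" for \<theta>'
    unfolding e_def using \<phi> g by auto
  have integral_e: "(\<integral>x. e \<theta>' x \<partial>M) = ((\<integral>x. \<phi> \<theta>' x \<partial>M) - (\<integral>x. \<phi> \<theta> x \<partial>M)
      - (\<theta>' - \<theta>) \<bullet> (\<integral>x. g x \<partial>M)) / norm (\<theta>' - \<theta>)" for \<theta>'
    unfolding e_def using \<phi> g by (simp add: inner_diff_left)
  have "((\<lambda>\<theta>'. \<integral>x. e \<theta>' x \<partial>M) \<longlongrightarrow> 0) (at \<theta>)"
    unfolding tendsto_at_iff_sequentially
  proof (intro allI impI)
    fix T :: "nat \<Rightarrow> 'p" assume T: "\<forall>i. T i \<in> UNIV - {\<theta>}" and lim: "T \<longlonglongrightarrow> \<theta>"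
    have "(\<lambda>i. norm (T i - \<theta>)) \<longlonglongrightarrow> 0" using lim by (simp add: LIM_zero tendsto_norm_zero)
    then have "\<forall>\<^sub>F i in sequentially. norm (T i - \<theta>) < 1"
      by (rule order_tendstoD) simp
    \<comment> \<open>The domination holds only within distance 1 of \<open>\<theta>\<close>, hence the shift of the sequence.\<close>
    then obtain N where N: "\<And>i. i \<ge> N \<Longrightarrow> norm (T i - \<theta>) < 1"
      by (auto simp: eventually_sequentially)
    have "(\<lambda>i. \<integral>x. e (T (i + N)) x \<partial>M) \<longlonglongrightarrow> (\<integral>x. 0 \<partial>M)"
    proof (rule integral_dominated_convergence[where w="\<lambda>x. L x + norm (g x)"])
      show "integrable M (\<lambda>x. L x + norm (g x))" using L g by auto
      show "e (T (i + N)) \<in> borel_measurable M" for i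
        using e_int by (rule borel_measurable_integrable)
      show "AE x in M. norm (e (T (i + N)) x) \<le> L x + norm (g x)" for i
      proof (rule AE_I2)
        fix x assume x: "x \<in> space M"
        let ?d = "T (i + N) - \<theta>"
        have d: "norm ?d > 0" using T by simp
        have "\<bar>\<phi> (T (i + N)) x - \<phi> \<theta> x\<bar> \<le> L x * norm ?d"
          using N[of "i + N"] x by (intro lip) auto
        moreover have "\<bar>?d \<bullet> g x\<bar> \<le> norm ?d * norm (g x)" by (rule Cauchy_Schwarz_ineq2)
        ultimately have "\<bar>\<phi> (T (i + N)) x - \<phi> \<theta> x - ?d \<bullet> g x\<bar> \<le> (L x + norm (g x)) * norm ?d"
          by (simp add: algebra_simps)
        then show "norm (e (T (i + N)) x) \<le> L x + norm (g x)"
          unfolding e_def using d by (simp add: pos_divide_le_eq)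
      qed
      show "AE x in M. (\<lambda>i. e (T (i + N)) x) \<longlonglongrightarrow> 0"
        using ae
      proof (rule AE_mp, intro AE_I2 impI)
        fix x assume "GDERIV (\<lambda>\<theta>. \<phi> \<theta> x) \<theta> :> g x"
        then have "((\<lambda>\<theta>'. norm (\<phi> \<theta>' x - \<phi> \<theta> x - (\<theta>' - \<theta>) \<bullet> g x) / norm (\<theta>' - \<theta>)) \<longlongrightarrow> 0) (at \<theta>)"
          unfolding gderiv_def by (simp add: has_derivative_iff_norm)
        then have "((\<lambda>\<theta>'. e \<theta>' x) \<longlongrightarrow> 0) (at \<theta>)"
          unfolding e_def by (subst tendsto_norm_zero_iff[symmetric]) simp
        then have "(\<lambda>i. e (T i) x) \<longlonglongrightarrow> 0"
          using T lim by (auto simp: tendsto_at_iff_sequentially comp_def)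
        then show "(\<lambda>i. e (T (i + N)) x) \<longlonglongrightarrow> 0" by (rule LIMSEQ_ignore_initial_segment)
      qed
    qed auto
    then have "(\<lambda>i. \<integral>x. e (T i) x \<partial>M) \<longlonglongrightarrow> 0" by (simp add: LIMSEQ_offset)
    then show "((\<lambda>\<theta>'. \<integral>x. e \<theta>' x \<partial>M) \<circ> T) \<longlonglongrightarrow> 0" by (simp add: comp_def)
  qed
  then have "((\<lambda>\<theta>'. norm ((\<integral>x. \<phi> \<theta>' x \<partial>M) - (\<integral>x. \<phi> \<theta> x \<partial>M)
      - (\<theta>' - \<theta>) \<bullet> (\<integral>x. g x \<partial>M)) / norm (\<theta>' - \<theta>)) \<longlongrightarrow> 0) (at \<theta>)"
    unfolding integral_e by (subst (asm) tendsto_norm_zero_iff[symmetric]) simp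
  then show ?thesis
    unfolding gderiv_def has_derivative_iff_norm
    by (simp add: bounded_linear_inner_left)
qed

lemma has_derivative_relu_shift:
  fixes \<theta> :: "real^'n::finite"
  assumes "p + \<theta> $ l \<noteq> 0"
  shows "((\<lambda>\<theta>. relu (p + \<theta> $ l)) has_derivative (\<lambda>h. (if p + \<theta> $ l \<ge> 0 then 1 else 0) * h $ l)) (at \<theta>)"
proof -
  have coord: "((\<lambda>\<theta>::real^'n. \<theta> $ l) has_derivative (\<lambda>h. h $ l)) (at \<theta>)"
    by (rule bounded_linear_imp_has_derivative[OF bounded_linear_vec_nth])
  have cont: "continuous_on UNIV (\<lambda>\<theta>::real^'n. p + \<theta> $ l)" by (intro continuous_intros)
  show ?thesis
  proof (cases "p + \<theta> $ l > 0")
    case True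
    have "((\<lambda>\<theta>. p + \<theta> $ l) has_derivative (\<lambda>h. 1 * h $ l)) (at \<theta>)"
      by (auto intro!: derivative_eq_intros coord)
    then have "((\<lambda>\<theta>. relu (p + \<theta> $ l)) has_derivative (\<lambda>h. 1 * h $ l)) (at \<theta>)"
    proof (rule has_derivative_transform_within_open)
      show "open {\<theta>::real^'n. 0 < p + \<theta> $ l}"
        by (intro open_Collect_less continuous_intros cont)
    qed (use True in \<open>auto simp: relu_def\<close>)
    then show ?thesis using True by simp
  next
    case False
    have "((\<lambda>\<theta>. 0) has_derivative (\<lambda>h. 0 * h $ l)) (at \<theta>)" by simp
    then have "((\<lambda>\<theta>. relu (p + \<theta> $ l)) has_derivative (\<lambda>h. 0 * h $ l)) (at \<theta>)"
    proof (rule has_derivative_transform_within_open)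
      show "open {\<theta>::real^'n. p + \<theta> $ l < 0}"
        by (intro open_Collect_less continuous_intros cont)
    qed (use False assms in \<open>auto simp: relu_def\<close>)
    then show ?thesis using False assms by simp
  qed
qed

text \<open>Away from the kinks of the activation functions, \<open>G\<close> is the classical gradient of the squared
  residual.\<close>

lemma GDERIV_squared_residual:
  fixes c :: "real^'k::finite^'d::finite" and \<theta> :: "('i::finite, 'd) par" and x :: "('i, 'k) dat"
  assumes "\<And>j. c $ j \<bullet> snd x + \<theta> $ Inr j \<noteq> 0"
  shows "GDERIV (\<lambda>\<theta>. (norm (fst x - network c \<theta> (snd x)))\<^sup>2) \<theta> :> G_grad c \<theta> x"
proof -
  define s where "s = (\<lambda>j (\<theta>::('i, 'd) par). relu (c $ j \<bullet> snd x + \<theta> $ Inr j))"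
  define a where "a = (\<lambda>j. if c $ j \<bullet> snd x + \<theta> $ Inr j \<ge> 0 then 1 else 0 :: real)"
  define e where "e = (\<lambda>i (\<theta>::('i, 'd) par). fst x $ i - (\<Sum>j\<in>UNIV. \<theta> $ Inl (i, j) * s j \<theta>))"
  define e' where "e' = (\<lambda>i (h::('i, 'd) par).
      0 - (\<Sum>j\<in>UNIV. \<theta> $ Inl (i, j) * (a j * h $ Inr j) + h $ Inl (i, j) * s j \<theta>))"
  have s: "(s j has_derivative (\<lambda>h. a j * h $ Inr j)) (at \<theta>)" for j
    unfolding s_def a_def by (rule has_derivative_relu_shift[OF assms])
  have coord: "((\<lambda>\<theta>::('i, 'd) par. \<theta> $ l) has_derivative (\<lambda>h. h $ l)) (at \<theta>)" for l
    by (rule bounded_linear_imp_has_derivative[OF bounded_linear_vec_nth])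
  have e: "(e i has_derivative e' i) (at \<theta>)" for i
    unfolding e_def e'_def
    by (intro has_derivative_diff has_derivative_const has_derivative_sum has_derivative_mult coord s)
  have "((\<lambda>\<theta>. \<Sum>i\<in>UNIV. e i \<theta> * e i \<theta>) has_derivative
      (\<lambda>h. \<Sum>i\<in>UNIV. e i \<theta> * e' i h + e' i h * e i \<theta>)) (at \<theta>)"
    by (intro has_derivative_sum has_derivative_mult e)
  moreover have "(\<lambda>\<theta>. (norm (fst x - network c \<theta> (snd x)))\<^sup>2) = (\<lambda>\<theta>. \<Sum>i\<in>UNIV. e i \<theta> * e i \<theta>)"
    by (rule ext) (simp add: power2_norm_eq_inner inner_vec_def network_def e_def s_def)
  moreover have "(\<Sum>i\<in>UNIV. e i \<theta> * e' i h + e' i h * e i \<theta>) = h \<bullet> G_grad c \<theta> x" for h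
  proof -
    have G: "G_grad c \<theta> x $ Inl (I, J) = - 2 * e I \<theta> * s J \<theta>"
      "G_grad c \<theta> x $ Inr J = - 2 * (\<Sum>i\<in>UNIV. e i \<theta> * \<theta> $ Inl (i, J) * a J)" for I J
      by (simp_all add: G_grad_def network_def e_def s_def a_def active_set_def indicator_def)
    have "(\<Sum>i\<in>UNIV. e i \<theta> * e' i h + e' i h * e i \<theta>)
        = (\<Sum>i\<in>UNIV. \<Sum>j\<in>UNIV. h $ Inl (i, j) * (- 2 * e i \<theta> * s j \<theta>)
            + h $ Inr j * (- 2 * (e i \<theta> * \<theta> $ Inl (i, j) * a j)))"
      unfolding e'_def
      by (intro sum.cong refl)
        (simp add: sum_distrib_left sum_distrib_right sum_negf[symmetric] sum.distrib[symmetric]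
          algebra_simps)
    also have "\<dots> = (\<Sum>i\<in>UNIV. \<Sum>j\<in>UNIV. h $ Inl (i, j) * (- 2 * e i \<theta> * s j \<theta>))
        + (\<Sum>j\<in>UNIV. \<Sum>i\<in>UNIV. h $ Inr j * (- 2 * (e i \<theta> * \<theta> $ Inl (i, j) * a j)))"
      by (simp only: sum.distrib) (subst (3) sum.swap, rule refl)
    also have "\<dots> = h \<bullet> G_grad c \<theta> x"
      unfolding inner_vec_def sum_par_index G by (simp add: sum_distrib_left)
    finally show ?thesis .
  qed
  ultimately show ?thesis unfolding gderiv_def by simp
qed

lemma G_grad_measurable:
  fixes c :: "real^'k::finite^'d::finite" and \<theta> :: "('i::finite, 'd) par"
  shows "(G_grad c \<theta> :: ('i, 'k) dat \<Rightarrow> _) \<in> borel_measurable borel"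
proof -
  have [measurable]: "(\<lambda>x::('i, 'k) dat. fst x $ i - network c \<theta> (snd x) $ i) \<in> borel_measurable borel" for i
    unfolding network_def relu_def by (intro borel_measurable_continuous_onI continuous_intros)
  have [measurable]: "(\<lambda>x::('i, 'k) dat. relu (c $ J \<bullet> snd x + \<theta> $ Inr J)) \<in> borel_measurable borel" for J
    unfolding relu_def by (intro borel_measurable_continuous_onI continuous_intros)
  have [measurable]: "(\<lambda>x::('i, 'k) dat. indicator (active_set c \<theta> J) (snd x) :: real) \<in> borel_measurable borel" for J
  proof -
    have "closed {x::('i, 'k) dat. c $ J \<bullet> snd x + \<theta> $ Inr J \<ge> 0}"
      by (intro closed_Collect_le continuous_intros)
    then have "(indicator {x::('i, 'k) dat. c $ J \<bullet> snd x + \<theta> $ Inr J \<ge> 0} :: _ \<Rightarrow> real) \<in> borel_measurable borel"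
      by (intro borel_measurable_indicator borel_closed)
    then show ?thesis by (simp add: indicator_def[abs_def] active_set_def)
  qed
  have "(\<lambda>x::('i, 'k) dat. G_grad c \<theta> x $ l) \<in> borel_measurable borel" for l
  proof (cases l)
    case (Inl p)
    obtain I J where p: "p = (I, J)" by force
    have "(\<lambda>x::('i, 'k) dat. G_grad c \<theta> x $ l)
        = (\<lambda>x. - 2 * (fst x $ I - network c \<theta> (snd x) $ I) * relu (c $ J \<bullet> snd x + \<theta> $ Inr J))"
      by (simp add: Inl p G_grad_def)
    then show ?thesis by (rule ssubst) measurable
  next
    case (Inr J)
    then have "(\<lambda>x::('i, 'k) dat. G_grad c \<theta> x $ l)
        = (\<lambda>x. - 2 * (\<Sum>i\<in>UNIV. (fst x $ i - network c \<theta> (snd x) $ i) * \<theta> $ Inl (i, J)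
            * indicator (active_set c \<theta> J) (snd x)))"
      by (simp add: G_grad_def)
    then show ?thesis by (rule ssubst) measurable
  qed
  then show ?thesis
    unfolding borel_measurable_euclidean_space[where f="G_grad c \<theta>"]
    by (auto simp: Basis_vec_def inner_axis)
qed

section \<open>The regularizer\<close>

lemma GDERIV_norm_power:
  fixes \<theta> :: "'p::real_inner"
  shows "GDERIV (\<lambda>\<theta>. norm \<theta> ^ (2 * (n + 1))) \<theta> :> (2 * (real n + 1) * norm \<theta> ^ (2 * n)) *\<^sub>R \<theta>"
proof -
  have eq: "norm x ^ (2 * m) = (x \<bullet> x) ^ m" for x :: 'p and m
    by (simp add: power_mult power2_norm_eq_inner)
  show ?thesis
    unfolding gderiv_def eq
    by (rule derivative_eq_intros refl | simp)+ (auto simp: fun_eq_iff inner_commute algebra_simps)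
qed

lemma F_grad_lipschitz:
  fixes \<theta> \<theta>' :: "('i::finite, 'd::finite) par" and x x' :: "('i, 'k::finite) dat"
  assumes "\<eta> \<ge> 0"
  shows "norm (F_grad \<eta> 2 \<theta> x - F_grad \<eta> 2 \<theta>' x')
    \<le> 5 * \<eta> * (1 + norm \<theta> + norm \<theta>') ^ 4 * norm (\<theta> - \<theta>')"
proof -
  define a where "a = norm \<theta>"
  define b where "b = norm \<theta>'"
  define \<delta> where "\<delta> = norm (\<theta> - \<theta>')"
  have ab: "0 \<le> a" "0 \<le> b" "0 \<le> \<delta>" "\<bar>a - b\<bar> \<le> \<delta>"
    unfolding a_def b_def \<delta>_def by (auto intro: norm_triangle_ineq3)
  have "F_grad \<eta> 2 \<theta> x - F_grad \<eta> 2 \<theta>' x' = \<eta> *\<^sub>R (a ^ 4 *\<^sub>R (\<theta> - \<theta>') + (a ^ 4 - b ^ 4) *\<^sub>R \<theta>')"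
    unfolding F_grad_def a_def b_def by (simp add: algebra_simps)
  then have "norm (F_grad \<eta> 2 \<theta> x - F_grad \<eta> 2 \<theta>' x')
      = \<eta> * norm (a ^ 4 *\<^sub>R (\<theta> - \<theta>') + (a ^ 4 - b ^ 4) *\<^sub>R \<theta>')"
    using assms by simp
  also have "\<dots> \<le> \<eta> * (a ^ 4 * \<delta> + \<bar>a ^ 4 - b ^ 4\<bar> * b)"
    using assms ab unfolding \<delta>_def b_def
    by (intro mult_left_mono order_trans[OF norm_triangle_ineq]) auto
  also have "\<dots> \<le> \<eta> * (5 * (1 + a + b) ^ 4 * \<delta>)"
  proof (rule mult_left_mono[OF _ assms])
    have pw: "a ^ 4 \<le> (1 + a + b) ^ 4" using ab by (intro power_mono) auto
    have "\<bar>a ^ 4 - b ^ 4\<bar> * b = \<bar>a - b\<bar> * ((a + b) * (a\<^sup>2 + b\<^sup>2) * b)"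
    proof -
      have "a ^ 4 - b ^ 4 = (a - b) * ((a + b) * (a\<^sup>2 + b\<^sup>2))" by algebra
      moreover have "0 \<le> (a + b) * (a\<^sup>2 + b\<^sup>2)" using ab by auto
      ultimately have "\<bar>a ^ 4 - b ^ 4\<bar> = \<bar>a - b\<bar> * ((a + b) * (a\<^sup>2 + b\<^sup>2))"
        by (simp only: abs_mult[of "a - b"] abs_of_nonneg)
      then show ?thesis by (simp only: mult.assoc)
    qed
    also have "\<dots> \<le> \<delta> * (1 + a + b) ^ 4"
    proof (intro mult_mono ab)
      have "(a + b) * (a\<^sup>2 + b\<^sup>2) * b \<le> (1 + a + b) * (1 + a + b)\<^sup>2 * (1 + a + b)"
      proof (intro mult_mono)
        have "a\<^sup>2 + b\<^sup>2 \<le> (a + b)\<^sup>2" using ab by (simp add: power2_sum)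
        also have "\<dots> \<le> (1 + a + b)\<^sup>2" using ab by (intro power_mono) auto
        finally show "a\<^sup>2 + b\<^sup>2 \<le> (1 + a + b)\<^sup>2" .
      qed (use ab in auto)
      also have "\<dots> = (1 + a + b) ^ 4" by algebra
      finally show "(a + b) * (a\<^sup>2 + b\<^sup>2) * b \<le> (1 + a + b) ^ 4" .
    qed (use ab in auto)
    finally have 1: "\<bar>a ^ 4 - b ^ 4\<bar> * b \<le> (1 + a + b) ^ 4 * \<delta>" by (simp add: mult.commute)
    have 2: "a ^ 4 * \<delta> \<le> (1 + a + b) ^ 4 * \<delta>" using pw ab by (intro mult_right_mono)
    have "0 \<le> (1 + a + b) ^ 4 * \<delta>" using ab by auto
    with 1 2 show "a ^ 4 * \<delta> + \<bar>a ^ 4 - b ^ 4\<bar> * b \<le> 5 * (1 + a + b) ^ 4 * \<delta>" by linarith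
  qed
  finally show ?thesis unfolding a_def b_def \<delta>_def by (simp add: mult_ac)
qed

lemma F_grad_bound:
  fixes \<theta> :: "('i::finite, 'd::finite) par" and x :: "('i, 'k::finite) dat"
  assumes "\<eta> \<ge> 0"
  shows "norm (F_grad \<eta> r \<theta> x) \<le> \<eta> * (1 + norm x) ^ n * (1 + norm \<theta> ^ (2 * r + 1))"
proof -
  have "norm (F_grad \<eta> r \<theta> x) = \<eta> * 1 * norm \<theta> ^ (2 * r + 1)"
    using assms unfolding F_grad_def by simp
  also have "\<dots> \<le> \<eta> * (1 + norm x) ^ n * (1 + norm \<theta> ^ (2 * r + 1))"
    using assms by (intro mult_mono one_le_power) auto
  finally show ?thesis .
qed

text \<open>With \<open>s = \<bar>\<theta>\<bar>\<^bsup>2r\<^esup>\<close> and \<open>t = \<bar>\<theta>'\<bar>\<^bsup>2r\<^esup>\<close>, polarization gives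
  \<open>(\<theta> - \<theta>') \<bullet> (s \<theta> - t \<theta>') = ((s + t) \<bar>\<theta> - \<theta>'\<bar>\<^sup>2 + (s - t) (\<bar>\<theta>\<bar>\<^sup>2 - \<bar>\<theta>'\<bar>\<^sup>2)) / 2\<close>,
  and the last product is nonnegative.\<close>

lemma F_grad_monotone:
  fixes \<theta> \<theta>' :: "('i::finite, 'd::finite) par" and x :: "('i, 'k::finite) dat"
  assumes "\<eta> \<ge> 0"
  shows "(\<theta> - \<theta>') \<bullet> (F_grad \<eta> r \<theta> x - F_grad \<eta> r \<theta>' x)
    \<ge> \<eta> / 2 * ((\<theta> - \<theta>') \<bullet> (\<theta> - \<theta>')) * (norm \<theta> ^ (2 * r) + norm \<theta>' ^ (2 * r))"
proof -
  define s where "s = norm \<theta> ^ (2 * r)"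
  define t where "t = norm \<theta>' ^ (2 * r)"
  have sgn: "0 \<le> (s - t) * (\<theta> \<bullet> \<theta> - \<theta>' \<bullet> \<theta>')"
  proof (cases "norm \<theta> \<le> norm \<theta>'")
    case True
    then have "s \<le> t" "\<theta> \<bullet> \<theta> \<le> \<theta>' \<bullet> \<theta>'"
      unfolding s_def t_def power2_norm_eq_inner[symmetric] by (auto intro: power_mono)
    then show ?thesis by (simp add: mult_nonpos_nonpos)
  next
    case False
    then have "t \<le> s" "\<theta>' \<bullet> \<theta>' \<le> \<theta> \<bullet> \<theta>"
      unfolding s_def t_def power2_norm_eq_inner[symmetric] by (auto intro: power_mono)
    then show ?thesis by simp
  qed
  have "(\<theta> - \<theta>') \<bullet> (F_grad \<eta> r \<theta> x - F_grad \<eta> r \<theta>' x)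
      = \<eta> / 2 * ((\<theta> - \<theta>') \<bullet> (\<theta> - \<theta>')) * (s + t) + \<eta> / 2 * ((s - t) * (\<theta> \<bullet> \<theta> - \<theta>' \<bullet> \<theta>'))"
    unfolding F_grad_def s_def[symmetric] t_def[symmetric]
    by (simp add: inner_diff_left inner_diff_right inner_commute field_simps)
  then show ?thesis using sgn assms unfolding s_def t_def by simp
qed

lemma eigenvalues_scaled_identity:
  "eigenvalues (a *\<^sub>R mat 1 :: real^'n^'n) = {a}"
proof -
  have eq: "(a *\<^sub>R mat 1 :: real^'n^'n) *v v = a *\<^sub>R v" for v
    by (simp add: scaleR_matrix_vector_assoc[symmetric])
  have "axis undefined 1 \<noteq> (0 :: real^'n)" by (simp add: axis_eq_0_iff)
  then show ?thesis unfolding eigenvalues_def eq by auto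
qed

section \<open>Expectations of the stochastic gradient\<close>

lemma G_grad_integrable:
  fixes c :: "real^'k::finite^'d::finite" and \<theta> :: "('i::finite, 'd) par"
  assumes [measurable]: "X \<in> borel_measurable M"
    and int: "integrable M (\<lambda>\<omega>. (1 + norm (X \<omega>))\<^sup>2)"
  shows "integrable M (\<lambda>\<omega>. G_grad c \<theta> (X \<omega> :: ('i, 'k) dat))"
proof (rule Bochner_Integration.integrable_bound)
  show "integrable M (\<lambda>\<omega>. 8 * real CARD('i) * (real CARD('d))\<^sup>2 * (1 + norm c)\<^sup>2
      * (1 + norm (X \<omega>))\<^sup>2 * (1 + norm \<theta>) ^ 4)"
    using int by simp
  show "(\<lambda>\<omega>. G_grad c \<theta> (X \<omega>)) \<in> borel_measurable M"
    by (rule measurable_compose[OF assms(1) G_grad_measurable])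
  show "AE \<omega> in M. norm (G_grad c \<theta> (X \<omega>)) \<le> norm (8 * real CARD('i) * (real CARD('d))\<^sup>2
      * (1 + norm c)\<^sup>2 * (1 + norm (X \<omega>))\<^sup>2 * (1 + norm \<theta>) ^ 4)"
    by (intro AE_I2 order_trans[OF G_grad_bound]) auto
qed

lemma squared_residual_integrable:
  fixes c :: "real^'k::finite^'d::finite" and \<theta> :: "('i::finite, 'd) par"
  assumes X: "X \<in> borel_measurable M"
    and int: "integrable M (\<lambda>\<omega>. (1 + norm (X \<omega> :: ('i, 'k) dat))\<^sup>2)"
  shows "integrable M (\<lambda>\<omega>. (norm (fst (X \<omega>) - network c \<theta> (snd (X \<omega>))))\<^sup>2)"
proof (rule Bochner_Integration.integrable_bound)
  \<comment> \<open>At the zero parameter the network vanishes, and the increment from there to \<open>\<theta>\<close> is controlled.\<close>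
  let ?L = "\<lambda>\<omega>. 8 * real CARD('i) * (real CARD('d))\<^sup>2 * (1 + norm c)\<^sup>2 * (1 + norm (X \<omega>))\<^sup>2
      * (1 + norm \<theta> + norm (0::('i, 'd) par)) ^ 3 * norm (\<theta> - 0) + (1 + norm (X \<omega>))\<^sup>2"
  show "integrable M ?L" using int by simp
  have "(\<lambda>x::('i, 'k) dat. (norm (fst x - network c \<theta> (snd x)))\<^sup>2) \<in> borel_measurable borel"
    unfolding network_def relu_def by (intro borel_measurable_continuous_onI continuous_intros)
  then show "(\<lambda>\<omega>. (norm (fst (X \<omega>) - network c \<theta> (snd (X \<omega>))))\<^sup>2) \<in> borel_measurable M"
    by (rule measurable_compose[OF X])
  show "AE \<omega> in M. norm ((norm (fst (X \<omega>) - network c \<theta> (snd (X \<omega>))))\<^sup>2) \<le> norm (?L \<omega>)"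
  proof (rule AE_I2)
    fix \<omega>
    have "network c (0::('i, 'd) par) (snd (X \<omega>)) = 0"
      by (simp add: network_def vec_eq_iff)
    then have "\<bar>(norm (fst (X \<omega>) - network c \<theta> (snd (X \<omega>))))\<^sup>2 - (norm (fst (X \<omega>)))\<^sup>2\<bar>
        \<le> ?L \<omega> - (1 + norm (X \<omega>))\<^sup>2"
      using squared_residual_lipschitz[of "X \<omega>" c \<theta> 0] by simp
    moreover have "(norm (fst (X \<omega>)))\<^sup>2 \<le> (1 + norm (X \<omega>))\<^sup>2"
      using norm_fst_le[of "fst (X \<omega>)" "snd (X \<omega>)"] by (intro power_mono) auto
    ultimately have "(norm (fst (X \<omega>) - network c \<theta> (snd (X \<omega>))))\<^sup>2 \<le> ?L \<omega>"
      by linarith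
    then have "\<bar>(norm (fst (X \<omega>) - network c \<theta> (snd (X \<omega>))))\<^sup>2\<bar> \<le> \<bar>?L \<omega>\<bar>"
      by (intro order_trans[OF _ abs_ge_self]) simp
    then show "norm ((norm (fst (X \<omega>) - network c \<theta> (snd (X \<omega>))))\<^sup>2) \<le> norm (?L \<omega>)"
      by (simp only: real_norm_def)
  qed
qed

text \<open>Taking expectations in the pointwise increment bound. The constant \<open>\<Lambda>\<close> stands for the
  anti-concentration of the preactivations. In the leading factor \<open>16 + 4 \<Lambda>\<close> the first term comes from
  the Lipschitz part and the second from the jumps.\<close>

lemma G_grad_expectation_lipschitz:
  fixes c :: "real^'k::finite^'d::finite" and \<theta> \<theta>' :: "('i::finite, 'd) par"
    and X :: "'a \<Rightarrow> ('i, 'k) dat"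
  assumes "prob_space M" and X[measurable]: "X \<in> borel_measurable M"
    and int: "integrable M (\<lambda>\<omega>. (1 + norm (X \<omega>))\<^sup>2)" and \<Lambda>: "0 \<le> \<Lambda>"
    and strip: "\<And>J i p q. p \<le> q \<Longrightarrow>
      (\<integral>\<omega>. (1 + \<bar>fst (X \<omega>) $ i\<bar> + norm (snd (X \<omega>))) * indicator {p..q} (c $ J \<bullet> snd (X \<omega>)) \<partial>M)
        \<le> 2 * \<Lambda> * (q - p) * (\<integral>\<omega>. 1 + norm (X \<omega>) \<partial>M)"
  shows "(\<integral>\<omega>. norm (G_grad c \<theta> (X \<omega>) - G_grad c \<theta>' (X \<omega>)) \<partial>M)
    \<le> (16 + 4 * \<Lambda>) * real CARD('i) * (real CARD('d))\<^sup>2 * (1 + norm c)\<^sup>2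
      * (\<integral>\<omega>. (1 + norm (X \<omega>))\<^sup>2 \<partial>M) * (1 + norm \<theta> + norm \<theta>') ^ 3 * norm (\<theta> - \<theta>')"
proof -
  interpret prob_space M by fact
  define S where "S = 1 + norm \<theta> + norm \<theta>'"
  define P where "P = 1 + norm c"
  define D where "D = real CARD('d)"
  define m where "m = real CARD('i)"
  define \<delta> where "\<delta> = norm (\<theta> - \<theta>')"
  define R where "R = (\<integral>\<omega>. (1 + norm (X \<omega>))\<^sup>2 \<partial>M)"
  define p where "p = (\<lambda>J. min (- \<theta> $ Inr J) (- \<theta>' $ Inr J))"
  define q where "q = (\<lambda>J. max (- \<theta> $ Inr J) (- \<theta>' $ Inr J))"
  define t where "t = (\<lambda>J i \<omega>. (1 + \<bar>fst (X \<omega>) $ i\<bar> + norm (snd (X \<omega>)))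
      * indicator {p J..q J} (c $ J \<bullet> snd (X \<omega>)))"
  have pos: "1 \<le> S" "1 \<le> P" "1 \<le> D" "1 \<le> m" "0 \<le> \<delta>" "0 \<le> R"
    unfolding S_def P_def D_def m_def \<delta>_def R_def by (auto simp: Suc_leI)
  have t_meas: "t J i \<in> borel_measurable M" for J i
  proof -
    have [measurable]: "(\<lambda>\<omega>. 1 + \<bar>fst (X \<omega>) $ i\<bar> + norm (snd (X \<omega>))) \<in> borel_measurable M"
      "(\<lambda>\<omega>. c $ J \<bullet> snd (X \<omega>)) \<in> borel_measurable M"
      by (rule measurable_compose[OF X], intro borel_measurable_continuous_onI continuous_intros)+
    show ?thesis unfolding t_def by measurable
  qed
  have t_int: "integrable M (t J i)" for J i
  proof (rule Bochner_Integration.integrable_bound)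
    show "integrable M (\<lambda>\<omega>. 2 * (1 + norm (X \<omega>))\<^sup>2)" using int by simp
    show "AE \<omega> in M. norm (t J i \<omega>) \<le> norm (2 * (1 + norm (X \<omega>))\<^sup>2)"
    proof (rule AE_I2)
      fix \<omega>
      have "\<bar>t J i \<omega>\<bar> \<le> 1 + \<bar>fst (X \<omega>) $ i\<bar> + norm (snd (X \<omega>))"
        unfolding t_def by (simp split: split_indicator)
      also have "\<dots> \<le> 2 * (1 + norm (X \<omega>))" by (rule one_plus_data_le)
      also have "\<dots> \<le> 2 * (1 + norm (X \<omega>))\<^sup>2"
        by (intro mult_left_mono self_le_power) auto
      finally show "norm (t J i \<omega>) \<le> norm (2 * (1 + norm (X \<omega>))\<^sup>2)" by simp
    qed
  qed (rule t_meas)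
  have t_le: "(\<integral>\<omega>. t J i \<omega> \<partial>M) \<le> 2 * \<Lambda> * \<delta> * R" for J i
  proof -
    have "q J - p J = \<bar>(\<theta> - \<theta>') $ Inr J\<bar>" unfolding p_def q_def by (simp add: min_def max_def)
    then have "q J - p J \<le> \<delta>" "p J \<le> q J"
      unfolding \<delta>_def using component_le_norm_cart[of "\<theta> - \<theta>'" "Inr J"] by auto
    have RX: "(\<integral>\<omega>. 1 + norm (X \<omega>) \<partial>M) \<le> R"
      unfolding R_def
    proof (rule integral_mono')
      show "1 + norm (X \<omega>) \<le> (1 + norm (X \<omega>))\<^sup>2" for \<omega> by (rule self_le_power) auto
    qed (use int in auto)
    have "(\<integral>\<omega>. t J i \<omega> \<partial>M) \<le> 2 * \<Lambda> * (q J - p J) * (\<integral>\<omega>. 1 + norm (X \<omega>) \<partial>M)"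
      unfolding t_def by (rule strip) fact
    also have "\<dots> \<le> 2 * \<Lambda> * \<delta> * R"
      using \<Lambda> \<open>q J - p J \<le> \<delta>\<close> \<open>p J \<le> q J\<close> pos RX
      by (intro mult_mono mult_left_mono integral_nonneg_AE) auto
    finally show ?thesis .
  qed
  define A where "A = 16 * m * D\<^sup>2 * P\<^sup>2"
  define B where "B = 2 * D * P * S ^ 3"
  have B0: "0 \<le> B" unfolding B_def using pos by auto
  have "(\<integral>\<omega>. norm (G_grad c \<theta> (X \<omega>) - G_grad c \<theta>' (X \<omega>)) \<partial>M)
      \<le> (\<integral>\<omega>. A * (1 + norm (X \<omega>))\<^sup>2 * S ^ 3 * \<delta>
          + (\<Sum>J\<in>UNIV. \<Sum>i\<in>UNIV. B * t J i \<omega>) \<partial>M)"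
  proof (rule integral_mono)
    show "integrable M (\<lambda>\<omega>. norm (G_grad c \<theta> (X \<omega>) - G_grad c \<theta>' (X \<omega>)))"
      by (intro integrable_norm Bochner_Integration.integrable_diff G_grad_integrable X int)
    show "integrable M (\<lambda>\<omega>. A * (1 + norm (X \<omega>))\<^sup>2 * S ^ 3 * \<delta>
          + (\<Sum>J\<in>UNIV. \<Sum>i\<in>UNIV. B * t J i \<omega>))"
      using int t_int by simp
    show "norm (G_grad c \<theta> (X \<omega>) - G_grad c \<theta>' (X \<omega>))
        \<le> A * (1 + norm (X \<omega>))\<^sup>2 * S ^ 3 * \<delta> + (\<Sum>J\<in>UNIV. \<Sum>i\<in>UNIV. B * t J i \<omega>)" for \<omega>
      using G_grad_diff_le[of c \<theta> "X \<omega>" \<theta>']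
      unfolding A_def B_def S_def P_def D_def m_def \<delta>_def t_def p_def q_def .
  qed
  also have "\<dots> = A * R * S ^ 3 * \<delta> + (\<Sum>J\<in>(UNIV::'d set). \<Sum>i\<in>(UNIV::'i set). B * (\<integral>\<omega>. t J i \<omega> \<partial>M))"
    using int t_int by (simp add: R_def)
  also have "\<dots> \<le> A * R * S ^ 3 * \<delta> + (\<Sum>J\<in>(UNIV::'d set). \<Sum>i\<in>(UNIV::'i set). B * (2 * \<Lambda> * \<delta> * R))"
    by (intro add_left_mono sum_mono mult_left_mono t_le B0)
  also have "\<dots> = A * R * S ^ 3 * \<delta> + 4 * \<Lambda> * m * D\<^sup>2 * P * R * S ^ 3 * \<delta>"
    by (simp add: B_def m_def[symmetric] D_def[symmetric] power2_eq_square)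
  also have "\<dots> \<le> A * R * S ^ 3 * \<delta> + 4 * \<Lambda> * m * D\<^sup>2 * P\<^sup>2 * R * S ^ 3 * \<delta>"
    using pos \<Lambda> by (intro add_left_mono mult_right_mono mult_left_mono self_le_power) auto
  also have "\<dots> = (16 + 4 * \<Lambda>) * m * D\<^sup>2 * P\<^sup>2 * R * S ^ 3 * \<delta>"
    unfolding A_def by (simp add: algebra_simps)
  finally show ?thesis unfolding S_def P_def D_def m_def \<delta>_def R_def .
qed

section \<open>The objective and its gradient\<close>

text \<open>For almost every data point none of the finitely many preactivations sits at a kink, so
  differentiation under the integral sign applies.\<close>

lemma GDERIV_objective:
  fixes c :: "real^'k::finite^'d::finite" and \<theta> :: "('i::finite, 'd) par"
    and X :: "'a \<Rightarrow> ('i, 'k) dat"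
  assumes "prob_space M" and X[measurable]: "X \<in> borel_measurable M"
    and int: "integrable M (\<lambda>\<omega>. (1 + norm (X \<omega>))\<^sup>2)"
    and null: "\<And>J p. AE \<omega> in M. c $ J \<bullet> snd (X \<omega>) \<noteq> p"
  shows "GDERIV (objective M X c \<eta> r) \<theta> :> (\<integral>\<omega>. H_grad c \<eta> r \<theta> (X \<omega>) \<partial>M)"
proof -
  interpret prob_space M by fact
  define L where "L = (\<lambda>\<omega>. 8 * real CARD('i) * (real CARD('d))\<^sup>2 * (1 + norm c)\<^sup>2
      * (1 + norm (X \<omega>))\<^sup>2 * (2 + 2 * norm \<theta>) ^ 3)"
  have G_int: "integrable M (\<lambda>\<omega>. G_grad c \<theta> (X \<omega>))" by (rule G_grad_integrable[OF X int])
  have "GDERIV (\<lambda>\<theta>. \<integral>\<omega>. (norm (fst (X \<omega>) - network c \<theta> (snd (X \<omega>))))\<^sup>2 \<partial>M) \<theta>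
      :> (\<integral>\<omega>. G_grad c \<theta> (X \<omega>) \<partial>M)"
  proof (rule GDERIV_integral[where L=L])
    show "integrable M (\<lambda>\<omega>. (norm (fst (X \<omega>) - network c \<theta> (snd (X \<omega>))))\<^sup>2)" for \<theta> :: "('i, 'd) par"
      by (rule squared_residual_integrable[OF X int])
    show "integrable M L" unfolding L_def using int by simp
    show "integrable M (\<lambda>\<omega>. G_grad c \<theta> (X \<omega>))" by fact
    fix \<theta>' :: "('i, 'd) par" and \<omega>
    assume near: "norm (\<theta>' - \<theta>) \<le> 1"
    have "norm \<theta>' \<le> norm \<theta> + norm (\<theta>' - \<theta>)" by (rule norm_triangle_sub)
    with near have "1 + norm \<theta>' + norm \<theta> \<le> 2 + 2 * norm \<theta>" by simp
    then have "(1 + norm \<theta>' + norm \<theta>) ^ 3 \<le> (2 + 2 * norm \<theta>) ^ 3" by (intro power_mono) auto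
    then have "8 * real CARD('i) * (real CARD('d))\<^sup>2 * (1 + norm c)\<^sup>2 * (1 + norm (X \<omega>))\<^sup>2
        * (1 + norm \<theta>' + norm \<theta>) ^ 3 * norm (\<theta>' - \<theta>) \<le> L \<omega> * norm (\<theta>' - \<theta>)"
      unfolding L_def by (intro mult_right_mono mult_left_mono) auto
    then show "\<bar>(norm (fst (X \<omega>) - network c \<theta>' (snd (X \<omega>))))\<^sup>2
        - (norm (fst (X \<omega>) - network c \<theta> (snd (X \<omega>))))\<^sup>2\<bar> \<le> L \<omega> * norm (\<theta>' - \<theta>)"
      by (rule order_trans[OF squared_residual_lipschitz])
  next
    have "AE \<omega> in M. \<forall>j\<in>UNIV. c $ j \<bullet> snd (X \<omega>) \<noteq> - (\<theta> $ Inr j)"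
      by (intro AE_finite_allI null) simp
    then show "AE \<omega> in M. GDERIV (\<lambda>\<theta>. (norm (fst (X \<omega>) - network c \<theta> (snd (X \<omega>))))\<^sup>2) \<theta>
        :> G_grad c \<theta> (X \<omega>)"
    proof (rule AE_mp, intro AE_I2 impI)
      fix \<omega> assume "\<forall>j\<in>UNIV. c $ j \<bullet> snd (X \<omega>) \<noteq> - (\<theta> $ Inr j)"
      then show "GDERIV (\<lambda>\<theta>. (norm (fst (X \<omega>) - network c \<theta> (snd (X \<omega>))))\<^sup>2) \<theta> :> G_grad c \<theta> (X \<omega>)"
        by (intro GDERIV_squared_residual) (auto simp: eq_neg_iff_add_eq_0)
    qed
  qed
  moreover have "GDERIV (\<lambda>\<theta>::('i, 'd) par. \<eta> / (2 * (real r + 1)) * norm \<theta> ^ (2 * (r + 1))) \<theta>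
      :> (\<eta> * norm \<theta> ^ (2 * r)) *\<^sub>R \<theta>"
  proof -
    have "((\<lambda>\<theta>::('i, 'd) par. norm \<theta> ^ (2 * (r + 1))) has_derivative
        (\<lambda>h. h \<bullet> ((2 * (real r + 1) * norm \<theta> ^ (2 * r)) *\<^sub>R \<theta>))) (at \<theta>)"
      using GDERIV_norm_power unfolding gderiv_def .
    then have "((\<lambda>\<theta>::('i, 'd) par. \<eta> / (2 * (real r + 1)) * norm \<theta> ^ (2 * (r + 1))) has_derivative
        (\<lambda>h. \<eta> / (2 * (real r + 1)) * (h \<bullet> ((2 * (real r + 1) * norm \<theta> ^ (2 * r)) *\<^sub>R \<theta>)))) (at \<theta>)"
      by (rule has_derivative_mult_right)
    moreover have "\<eta> / (2 * (real r + 1)) * (h \<bullet> ((2 * (real r + 1) * norm \<theta> ^ (2 * r)) *\<^sub>R \<theta>))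
        = h \<bullet> ((\<eta> * norm \<theta> ^ (2 * r)) *\<^sub>R \<theta>)" for h
    proof -
      have "2 * (real r + 1) \<noteq> 0" by (simp add: add_nonneg_eq_0_iff)
      then show ?thesis by (simp only: inner_scaleR_right times_divide_eq_left) (simp add: mult_ac)
    qed
    ultimately show ?thesis unfolding gderiv_def by (simp only:)
  qed
  ultimately have "GDERIV (objective M X c \<eta> r) \<theta>
      :> (\<integral>\<omega>. G_grad c \<theta> (X \<omega>) \<partial>M) + (\<eta> * norm \<theta> ^ (2 * r)) *\<^sub>R \<theta>"
    unfolding objective_def[abs_def] by (rule GDERIV_add)
  moreover have "(\<integral>\<omega>. H_grad c \<eta> r \<theta> (X \<omega>) \<partial>M)
      = (\<integral>\<omega>. G_grad c \<theta> (X \<omega>) \<partial>M) + (\<eta> * norm \<theta> ^ (2 * r)) *\<^sub>R \<theta>"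
    unfolding H_grad_def F_grad_def using G_int by (simp add: prob_space)
  ultimately show ?thesis by simp
qed

theorem proposition3p1:
  fixes M :: "'a measure"
    and X :: "'a \<Rightarrow> ('i::finite, 'k::{finite, linorder}) dat"
    and Xs :: "nat \<Rightarrow> 'a \<Rightarrow> ('i, 'k) dat"
    and \<theta>0 :: "'a \<Rightarrow> ('i, 'd::finite) par"
    and c :: "real^'k::{finite, linorder}^'d"
    and \<eta> :: real
    and q r \<rho> rbar :: nat
    and f :: "'k \<Rightarrow> 'i \<Rightarrow> real \<Rightarrow> ('k \<Rightarrow> real) \<times> real \<Rightarrow> real"
    and C Cbar :: "'k \<Rightarrow> real"
    and Cmax Cbarmax L_G K_G L_F K_F a b :: real
    and A B :: "('i, 'k) dat \<Rightarrow> real^(('i \<times> 'd) + 'd)^(('i \<times> 'd) + 'd)"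
  assumes "prob_space M"
    and "q = 4" and "r = 2" and "\<rho> = 2" and "\<eta> > 0"
    and rows: "\<And>J. \<exists>K. c $ J $ K \<noteq> 0"
    and cont: "\<exists>p. distributed M lborel X p"
    and dens: "\<And>I K. conditional_density M
                 (Pi\<^sub>M (- {K}) (\<lambda>_. borel) \<Otimes>\<^sub>M borel)
                 (\<lambda>\<omega>. snd (X \<omega>) $ K)
                 (\<lambda>\<omega>. (drop_coord K (snd (X \<omega>)), fst (X \<omega>) $ I))
                 (f K I)"
    and C_pos: "\<And>K. C K > 0" "\<And>K. Cbar K > 0"
    and C_bound: "\<And>I K (z :: (real, 'k) vec) (y :: real). f K I (z $ K) (drop_coord K z, y) \<le> C K"
    and Cbar_bound: "\<And>I K (z :: (real, 'k) vec) (y :: real).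
                       \<bar>z $ K\<bar>\<^sup>2 * f K I (z $ K) (drop_coord K z, y) \<le> Cbar K"
    and indep: "prob_space.indep_vars M (\<lambda>_. borel) Xs UNIV"
    and law: "\<And>n. distr M borel (Xs n) = distr M borel X"
    and \<theta>0_meas: "\<theta>0 \<in> borel_measurable M"
    and moments: "integrable M (\<lambda>\<omega>. norm (\<theta>0 \<omega>) ^ 20 + norm (Xs 0 \<omega>) ^ 40)"
    and Cmax: "Cmax = (MAX J. C (first_nonzero c J) / \<bar>c $ J $ first_nonzero c J\<bar>)"
    and Cbarmax: "Cbarmax = (MAX J. Cbar (first_nonzero c J) / \<bar>c $ J $ first_nonzero c J\<bar>)"
    and L_G: "L_G = 55 * real CARD('i) * (real CARD('d))\<^sup>2 * (1 + norm c)\<^sup>2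
                      * (1 + Cmax + Cbarmax) * (\<integral>\<omega>. (1 + norm (Xs 0 \<omega>))\<^sup>2 \<partial>M)"
    and K_G: "K_G = 8 * real CARD('i) * (real CARD('d))\<^sup>2 * (1 + norm c)\<^sup>2"
    and L_F: "L_F = 5 * \<eta>" and K_F: "K_F = \<eta>"
    and A: "\<And>x. A x = (\<eta> / 2) *\<^sub>R mat 1" and B: "\<And>x. B x = 0"
    and "rbar = 0" and "a = \<eta> / 2" and "b = 0"
  shows
    "((\<forall>\<theta>::('i, 'd) par. integrable M (\<lambda>\<omega>. (norm (fst (X \<omega>) - network c \<theta> (snd (X \<omega>))))\<^sup>2)) \<and>
      (\<exists>h. (\<forall>\<theta>. GDERIV (objective M X c \<eta> r) \<theta> :> h \<theta>) \<and> continuous_on UNIV h \<and>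
           integrable M (\<lambda>\<omega>. norm (\<theta>0 \<omega>) ^ (4 * (2 * r + 1))) \<and>
           integrable M (\<lambda>\<omega>. norm (Xs 0 \<omega>) ^ (4 * (2 * r + 1) * \<rho>)) \<and>
           (\<forall>\<theta>. integrable M (\<lambda>\<omega>. H_grad c \<eta> r \<theta> (Xs 0 \<omega>)) \<and>
                h \<theta> = (\<integral>\<omega>. H_grad c \<eta> r \<theta> (Xs 0 \<omega>) \<partial>M))))
     \<and>
     ((\<forall>\<theta> \<theta>'. integrable M (\<lambda>\<omega>. norm (G_grad c \<theta> (Xs 0 \<omega>) - G_grad c \<theta>' (Xs 0 \<omega>))) \<and>
              (\<integral>\<omega>. norm (G_grad c \<theta> (Xs 0 \<omega>) - G_grad c \<theta>' (Xs 0 \<omega>)) \<partial>M)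
                \<le> L_G * (1 + norm \<theta> + norm \<theta>') ^ (q - 1) * norm (\<theta> - \<theta>')) \<and>
      (\<forall>(\<theta>::('i, 'd) par) (x::('i, 'k) dat). norm (G_grad c \<theta> x) \<le> K_G * (1 + norm x) ^ \<rho> * (1 + norm \<theta>) ^ q))
     \<and>
     ((\<forall>(\<theta>::('i, 'd) par) \<theta>' (x::('i, 'k) dat) x'.
         norm (F_grad \<eta> r \<theta> x - F_grad \<eta> r \<theta>' x')
           \<le> L_F * (1 + norm x + norm x') ^ (\<rho> - 1) * (1 + norm \<theta> + norm \<theta>') ^ (2 * r)
               * (norm (\<theta> - \<theta>') + norm (x - x'))) \<and>
      (\<forall>(\<theta>::('i, 'd) par) (x::('i, 'k) dat).
         norm (F_grad \<eta> r \<theta> x) \<le> K_F * (1 + norm x) ^ \<rho> * (1 + norm \<theta> ^ (2 * r + 1))))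
     \<and>
     ((\<forall>x v. v \<bullet> (A x *v v) \<ge> 0 \<and> v \<bullet> (B x *v v) \<ge> 0) \<and>
      (\<forall>\<theta> \<theta>' x.
         (\<theta> - \<theta>') \<bullet> (F_grad \<eta> r \<theta> x - F_grad \<eta> r \<theta>' x)
           \<ge> (\<theta> - \<theta>') \<bullet> (A x *v (\<theta> - \<theta>')) * (norm \<theta> ^ (2 * r) + norm \<theta>' ^ (2 * r))
             - (\<theta> - \<theta>') \<bullet> (B x *v (\<theta> - \<theta>')) * (norm \<theta> ^ rbar + norm \<theta>' ^ rbar)) \<and>
      (a \<in> eigenvalues (\<integral>\<omega>. A (Xs 0 \<omega>) \<partial>M) \<and>
       (\<forall>l \<in> eigenvalues (\<integral>\<omega>. A (Xs 0 \<omega>) \<partial>M). a \<le> l) \<and> a > 0) \<and>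
      (b \<in> eigenvalues (\<integral>\<omega>. B (Xs 0 \<omega>) \<partial>M) \<and>
       (\<forall>l \<in> eigenvalues (\<integral>\<omega>. B (Xs 0 \<omega>) \<partial>M). l \<le> b) \<and> b \<ge> 0))"
proof -
  interpret prob_space M by fact
  note r = \<open>q = 4\<close> \<open>r = 2\<close> \<open>\<rho> = 2\<close> \<open>rbar = 0\<close> \<open>a = \<eta> / 2\<close> \<open>b = 0\<close>
  have \<eta>: "0 \<le> \<eta>" using \<open>\<eta> > 0\<close> by simp
  have X[measurable]: "X \<in> borel_measurable M"
    using cont unfolding distributed_def by auto
  have X0[measurable]: "Xs 0 \<in> borel_measurable M"
    using indep unfolding indep_vars_def by auto
  \<comment> \<open>The gradient estimates are proved for \<open>X\<close> and transferred to \<open>Xs 0\<close>, which has the same law.\<close>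
  have law_int: "integrable M (\<lambda>\<omega>. g (Xs 0 \<omega>)) \<longleftrightarrow> integrable M (\<lambda>\<omega>. g (X \<omega>))"
    and law_eq: "(\<integral>\<omega>. g (Xs 0 \<omega>) \<partial>M) = (\<integral>\<omega>. g (X \<omega>) \<partial>M)"
    if "g \<in> borel_measurable borel" for g :: "('i, 'k) dat \<Rightarrow> 'z::{banach, second_countable_topology}"
    using integrable_distr_eq[OF X0 that] integrable_distr_eq[OF X that]
      integral_distr[OF X0 that] integral_distr[OF X that] law[of 0] by simp_all
  have mom_\<theta>: "integrable M (\<lambda>\<omega>. norm (\<theta>0 \<omega>) ^ 20)"
    using moments by (rule Bochner_Integration.integrable_bound) (use \<theta>0_meas in auto)
  have mom_X0: "integrable M (\<lambda>\<omega>. norm (Xs 0 \<omega>) ^ 40)"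
    using moments by (rule Bochner_Integration.integrable_bound) auto
  have sq_int0: "integrable M (\<lambda>\<omega>. (1 + norm (Xs 0 \<omega>))\<^sup>2)"
  proof (rule Bochner_Integration.integrable_bound)
    show "integrable M (\<lambda>\<omega>. 4 * (1 + norm (Xs 0 \<omega>) ^ 40))" using mom_X0 by simp
    show "AE \<omega> in M. norm ((1 + norm (Xs 0 \<omega>))\<^sup>2) \<le> norm (4 * (1 + norm (Xs 0 \<omega>) ^ 40))"
    proof (rule AE_I2)
      fix \<omega>
      have "(1 + y)\<^sup>2 \<le> 4 * (1 + y ^ 40)" if "0 \<le> y" for y :: real
      proof (cases "y \<le> 1")
        case True
        then have "(1 + y)\<^sup>2 \<le> 2\<^sup>2" using that by (intro power_mono) auto
        also have "\<dots> \<le> 4 * (1 + y ^ 40)" using that by simp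
        finally show ?thesis .
      next
        case False
        then have "(1 + y)\<^sup>2 \<le> (2 * y)\<^sup>2" using that by (intro power_mono) auto
        also have "\<dots> = 4 * y\<^sup>2" by (simp add: power_mult_distrib)
        also have "\<dots> \<le> 4 * y ^ 40" using False by (intro mult_left_mono power_increasing) auto
        finally show ?thesis by simp
      qed
      from this[of "norm (Xs 0 \<omega>)"]
      show "norm ((1 + norm (Xs 0 \<omega>))\<^sup>2) \<le> norm (4 * (1 + norm (Xs 0 \<omega>) ^ 40))"
        by simp
    qed
  qed auto
  have sq_int: "integrable M (\<lambda>\<omega>. (1 + norm (X \<omega>))\<^sup>2)"
    using sq_int0 law_int[of "\<lambda>x. (1 + norm x)\<^sup>2"] by simp
  have X_int: "integrable M (\<lambda>\<omega>. norm (X \<omega>))"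
    using sq_int
  proof (rule Bochner_Integration.integrable_bound)
    show "AE \<omega> in M. norm (norm (X \<omega>)) \<le> norm ((1 + norm (X \<omega>))\<^sup>2)"
      by (intro AE_I2) (simp add: power2_eq_square algebra_simps add_increasing)
  qed simp
  define \<nu> where "\<nu> = first_nonzero c"
  have \<nu>: "c $ J $ \<nu> J \<noteq> 0" for J
    using Min_in[of "{K. c $ J $ K \<noteq> 0}"] rows[of J] unfolding \<nu>_def first_nonzero_def by auto
  have Cmax_ge: "C (\<nu> J) / \<bar>c $ J $ \<nu> J\<bar> \<le> Cmax" and Cbarmax_ge: "Cbar (\<nu> J) / \<bar>c $ J $ \<nu> J\<bar> \<le> Cbarmax" for J
    unfolding Cmax Cbarmax \<nu>_def by (auto intro!: Max_ge)
  have C0: "0 \<le> C K" "0 \<le> Cbar K" for K using C_pos[of K] by auto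
  define \<Lambda> where "\<Lambda> = Cmax + Cbarmax"
  have \<Lambda>_ge: "(C (\<nu> J) + Cbar (\<nu> J)) / \<bar>c $ J $ \<nu> J\<bar> \<le> \<Lambda>" for J
    using Cmax_ge[of J] Cbarmax_ge[of J] unfolding \<Lambda>_def by (simp add: add_divide_distrib)
  have \<Lambda>0: "0 \<le> \<Lambda>"
    using \<Lambda>_ge[of undefined] C0[of "\<nu> undefined"] by (meson abs_ge_zero add_nonneg_nonneg divide_nonneg_nonneg order_trans)
  have strip: "(\<integral>\<omega>. (1 + \<bar>fst (X \<omega>) $ i\<bar> + norm (snd (X \<omega>))) * indicator {p..q} (c $ J \<bullet> snd (X \<omega>)) \<partial>M)
        \<le> 2 * \<Lambda> * (q - p) * (\<integral>\<omega>. 1 + norm (X \<omega>) \<partial>M)" if "p \<le> q" for J i p q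
  proof -
    have "(\<integral>\<omega>. (1 + \<bar>fst (X \<omega>) $ i\<bar> + norm (snd (X \<omega>))) * indicator {p..q} (c $ J \<bullet> snd (X \<omega>)) \<partial>M)
        \<le> 2 * ((C (\<nu> J) + Cbar (\<nu> J)) / \<bar>c $ J $ \<nu> J\<bar>) * (q - p) * (\<integral>\<omega>. 1 + norm (X \<omega>) \<partial>M)"
      by (rule strip_expectation_le[OF \<open>prob_space M\<close> X X_int dens C0 C_bound Cbar_bound \<nu> that])
    also have "\<dots> \<le> 2 * \<Lambda> * (q - p) * (\<integral>\<omega>. 1 + norm (X \<omega>) \<partial>M)"
      using that by (intro mult_right_mono mult_left_mono \<Lambda>_ge integral_nonneg_AE) auto
    finally show ?thesis .
  qed
  have null: "AE \<omega> in M. c $ J \<bullet> snd (X \<omega>) \<noteq> p" for J p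
    by (rule hyperplane_null[OF \<open>prob_space M\<close> X X_int dens C0 C_bound Cbar_bound \<nu>])
  define h where "h = (\<lambda>\<theta>::('i, 'd) par. \<integral>\<omega>. H_grad c \<eta> r \<theta> (X \<omega>) \<partial>M)"
  have G_int: "integrable M (\<lambda>\<omega>. G_grad c \<theta> (X \<omega>))" for \<theta> :: "('i, 'd) par"
    by (rule G_grad_integrable[OF X sq_int])
  have H_int: "integrable M (\<lambda>\<omega>. H_grad c \<eta> r \<theta> (X \<omega>))" for \<theta> :: "('i, 'd) par"
    unfolding H_grad_def F_grad_def using G_int by simp
  have H_meas: "(\<lambda>x::('i, 'k) dat. H_grad c \<eta> r \<theta> x) \<in> borel_measurable borel" for \<theta> :: "('i, 'd) par"
    unfolding H_grad_def F_grad_def using G_grad_measurable by measurable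
  have G_lip: "(\<integral>\<omega>. norm (G_grad c \<theta> (X \<omega>) - G_grad c \<theta>' (X \<omega>)) \<partial>M)
      \<le> L_G * (1 + norm \<theta> + norm \<theta>') ^ 3 * norm (\<theta> - \<theta>')" for \<theta> \<theta>' :: "('i, 'd) par"
  proof -
    let ?R = "\<integral>\<omega>. (1 + norm (X \<omega>))\<^sup>2 \<partial>M"
    let ?Q = "real CARD('i) * (real CARD('d))\<^sup>2 * (1 + norm c)\<^sup>2"
    have L_G': "L_G = 55 * (1 + \<Lambda>) * (?Q * ?R)"
      unfolding L_G \<Lambda>_def using law_eq[of "\<lambda>x. (1 + norm x)\<^sup>2"] by simp
    have "(\<integral>\<omega>. norm (G_grad c \<theta> (X \<omega>) - G_grad c \<theta>' (X \<omega>)) \<partial>M)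
        \<le> (16 + 4 * \<Lambda>) * (?Q * ?R) * (1 + norm \<theta> + norm \<theta>') ^ 3 * norm (\<theta> - \<theta>')"
      using G_grad_expectation_lipschitz[OF \<open>prob_space M\<close> X sq_int \<Lambda>0 strip, of \<theta> \<theta>']
      by (simp only: mult.assoc)
    \<comment> \<open>\<open>16 + 4 \<Lambda> \<le> 55 (1 + \<Lambda>)\<close>\<close>
    also have "\<dots> \<le> L_G * (1 + norm \<theta> + norm \<theta>') ^ 3 * norm (\<theta> - \<theta>')"
      unfolding L_G' using \<Lambda>0 by (intro mult_right_mono mult_nonneg_nonneg integral_nonneg_AE) auto
    finally show ?thesis .
  qed
  have h_eq: "h \<theta> = (\<eta> * norm \<theta> ^ 4) *\<^sub>R \<theta> + (\<integral>\<omega>. G_grad c \<theta> (X \<omega>) \<partial>M)" for \<theta>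
    unfolding h_def H_grad_def F_grad_def using G_int \<open>r = 2\<close> by (simp add: prob_space)
  have h_cont: "continuous_on UNIV h"
  proof -
    have "isCont (\<lambda>\<theta>. \<integral>\<omega>. G_grad c \<theta> (X \<omega>) \<partial>M) \<theta>" for \<theta> :: "('i, 'd) par"
    proof -
      have "((\<lambda>\<theta>'. (\<integral>\<omega>. G_grad c \<theta>' (X \<omega>) \<partial>M) - (\<integral>\<omega>. G_grad c \<theta> (X \<omega>) \<partial>M)) \<longlongrightarrow> 0) (at \<theta>)"
      proof (rule Lim_null_comparison)
        have "((\<lambda>\<theta>'. L_G * (1 + norm \<theta>' + norm \<theta>) ^ 3 * norm (\<theta>' - \<theta>))
            \<longlongrightarrow> L_G * (1 + norm \<theta> + norm \<theta>) ^ 3 * norm (\<theta> - \<theta>)) (at \<theta>)"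
          by (intro tendsto_intros)
        then show "((\<lambda>\<theta>'. L_G * (1 + norm \<theta>' + norm \<theta>) ^ 3 * norm (\<theta>' - \<theta>)) \<longlongrightarrow> 0) (at \<theta>)"
          by simp
        have "norm ((\<integral>\<omega>. G_grad c \<theta>' (X \<omega>) \<partial>M) - (\<integral>\<omega>. G_grad c \<theta> (X \<omega>) \<partial>M))
            \<le> L_G * (1 + norm \<theta>' + norm \<theta>) ^ 3 * norm (\<theta>' - \<theta>)" for \<theta>'
        proof -
          have "(\<integral>\<omega>. G_grad c \<theta>' (X \<omega>) \<partial>M) - (\<integral>\<omega>. G_grad c \<theta> (X \<omega>) \<partial>M)
              = (\<integral>\<omega>. G_grad c \<theta>' (X \<omega>) - G_grad c \<theta> (X \<omega>) \<partial>M)"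
            using G_int by simp
          then show ?thesis by (simp only:) (rule order_trans[OF integral_norm_bound G_lip])
        qed
        then show "\<forall>\<^sub>F \<theta>' in at \<theta>. norm ((\<integral>\<omega>. G_grad c \<theta>' (X \<omega>) \<partial>M) - (\<integral>\<omega>. G_grad c \<theta> (X \<omega>) \<partial>M))
            \<le> L_G * (1 + norm \<theta>' + norm \<theta>) ^ 3 * norm (\<theta>' - \<theta>)" by simp
      qed
      then show ?thesis unfolding isCont_def by (rule LIM_zero_cancel)
    qed
    then have "continuous_on UNIV (\<lambda>\<theta>::('i, 'd) par. \<integral>\<omega>. G_grad c \<theta> (X \<omega>) \<partial>M)"
      by (simp add: continuous_at_imp_continuous_on)
    then show ?thesis unfolding h_eq[abs_def] by (intro continuous_intros)
  qed
  have eigA: "eigenvalues (\<integral>\<omega>. A (Xs 0 \<omega>) \<partial>M) = {\<eta> / 2}"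
    unfolding A by (simp add: prob_space eigenvalues_scaled_identity)
  have eigB: "eigenvalues (\<integral>\<omega>. B (Xs 0 \<omega>) \<partial>M) = {0}"
    unfolding B using eigenvalues_scaled_identity[of 0, where 'n="('i \<times> 'd) + 'd"] by simp
  have Av: "A x *v v = (\<eta> / 2) *\<^sub>R v" for x v
    unfolding A by (simp add: scaleR_matrix_vector_assoc[symmetric])
  have Bv: "B x *v v = 0" for x v unfolding B by simp
  have part1: "(\<forall>\<theta>::('i, 'd) par. integrable M (\<lambda>\<omega>. (norm (fst (X \<omega>) - network c \<theta> (snd (X \<omega>))))\<^sup>2)) \<and>
      (\<exists>h. (\<forall>\<theta>. GDERIV (objective M X c \<eta> r) \<theta> :> h \<theta>) \<and> continuous_on UNIV h \<and>
           integrable M (\<lambda>\<omega>. norm (\<theta>0 \<omega>) ^ (4 * (2 * r + 1))) \<and>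
           integrable M (\<lambda>\<omega>. norm (Xs 0 \<omega>) ^ (4 * (2 * r + 1) * \<rho>)) \<and>
           (\<forall>\<theta>::('i, 'd) par. integrable M (\<lambda>\<omega>. H_grad c \<eta> r \<theta> (Xs 0 \<omega>)) \<and>
                h \<theta> = (\<integral>\<omega>. H_grad c \<eta> r \<theta> (Xs 0 \<omega>) \<partial>M)))"
  proof (intro conjI allI exI[of _ h])
    fix \<theta> :: "('i, 'd) par"
    show "integrable M (\<lambda>\<omega>. (norm (fst (X \<omega>) - network c \<theta> (snd (X \<omega>))))\<^sup>2)"
      by (rule squared_residual_integrable[OF X sq_int])
    show "GDERIV (objective M X c \<eta> r) \<theta> :> h \<theta>"
      unfolding h_def by (rule GDERIV_objective[OF \<open>prob_space M\<close> X sq_int null])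
    show "integrable M (\<lambda>\<omega>. H_grad c \<eta> r \<theta> (Xs 0 \<omega>))"
      using H_int law_int[OF H_meas] by blast
    show "h \<theta> = (\<integral>\<omega>. H_grad c \<eta> r \<theta> (Xs 0 \<omega>) \<partial>M)"
      unfolding h_def by (rule law_eq[OF H_meas, symmetric])
    show "integrable M (\<lambda>\<omega>. norm (\<theta>0 \<omega>) ^ (4 * (2 * r + 1)))"
      using mom_\<theta> \<open>r = 2\<close> by simp
    show "integrable M (\<lambda>\<omega>. norm (Xs 0 \<omega>) ^ (4 * (2 * r + 1) * \<rho>))"
      using mom_X0 \<open>r = 2\<close> \<open>\<rho> = 2\<close> by simp
  qed (rule h_cont)
  have part2: "(\<forall>(\<theta>::('i, 'd) par) \<theta>'. integrable M (\<lambda>\<omega>. norm (G_grad c \<theta> (Xs 0 \<omega>) - G_grad c \<theta>' (Xs 0 \<omega>))) \<and>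
              (\<integral>\<omega>. norm (G_grad c \<theta> (Xs 0 \<omega>) - G_grad c \<theta>' (Xs 0 \<omega>)) \<partial>M)
                \<le> L_G * (1 + norm \<theta> + norm \<theta>') ^ (q - 1) * norm (\<theta> - \<theta>')) \<and>
      (\<forall>(\<theta>::('i, 'd) par) (x::('i, 'k) dat). norm (G_grad c \<theta> x) \<le> K_G * (1 + norm x) ^ \<rho> * (1 + norm \<theta>) ^ q)"
  proof (intro conjI allI)
    fix \<theta> \<theta>' :: "('i, 'd) par"
    have [measurable]: "(\<lambda>x::('i, 'k) dat. norm (G_grad c \<theta> x - G_grad c \<theta>' x)) \<in> borel_measurable borel"
      using G_grad_measurable by measurable
    show "integrable M (\<lambda>\<omega>. norm (G_grad c \<theta> (Xs 0 \<omega>) - G_grad c \<theta>' (Xs 0 \<omega>)))"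
      by (intro integrable_norm Bochner_Integration.integrable_diff G_grad_integrable X0 sq_int0)
    show "(\<integral>\<omega>. norm (G_grad c \<theta> (Xs 0 \<omega>) - G_grad c \<theta>' (Xs 0 \<omega>)) \<partial>M)
        \<le> L_G * (1 + norm \<theta> + norm \<theta>') ^ (q - 1) * norm (\<theta> - \<theta>')"
      using G_lip[of \<theta> \<theta>'] law_eq[of "\<lambda>x. norm (G_grad c \<theta> x - G_grad c \<theta>' x)"] \<open>q = 4\<close> by simp
  next
    fix \<theta> :: "('i, 'd) par" and x :: "('i, 'k) dat"
    show "norm (G_grad c \<theta> x) \<le> K_G * (1 + norm x) ^ \<rho> * (1 + norm \<theta>) ^ q"
      unfolding K_G \<open>q = 4\<close> \<open>\<rho> = 2\<close> by (rule G_grad_bound)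
  qed
  have part3: "(\<forall>(\<theta>::('i, 'd) par) \<theta>' (x::('i, 'k) dat) x'.
         norm (F_grad \<eta> r \<theta> x - F_grad \<eta> r \<theta>' x')
           \<le> L_F * (1 + norm x + norm x') ^ (\<rho> - 1) * (1 + norm \<theta> + norm \<theta>') ^ (2 * r)
               * (norm (\<theta> - \<theta>') + norm (x - x'))) \<and>
      (\<forall>(\<theta>::('i, 'd) par) (x::('i, 'k) dat).
         norm (F_grad \<eta> r \<theta> x) \<le> K_F * (1 + norm x) ^ \<rho> * (1 + norm \<theta> ^ (2 * r + 1)))"
  proof (intro conjI allI)
    fix \<theta> \<theta>' :: "('i, 'd) par" and x x' :: "('i, 'k) dat"
    have "norm (F_grad \<eta> 2 \<theta> x - F_grad \<eta> 2 \<theta>' x')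
        \<le> 5 * \<eta> * 1 * (1 + norm \<theta> + norm \<theta>') ^ 4 * norm (\<theta> - \<theta>')"
      using F_grad_lipschitz[OF \<eta>, of \<theta> x \<theta>' x'] by simp
    also have "\<dots> \<le> 5 * \<eta> * (1 + norm x + norm x') * (1 + norm \<theta> + norm \<theta>') ^ 4
        * (norm (\<theta> - \<theta>') + norm (x - x'))"
      using \<eta> by (intro mult_mono) auto
    finally show "norm (F_grad \<eta> r \<theta> x - F_grad \<eta> r \<theta>' x')
           \<le> L_F * (1 + norm x + norm x') ^ (\<rho> - 1) * (1 + norm \<theta> + norm \<theta>') ^ (2 * r)
               * (norm (\<theta> - \<theta>') + norm (x - x'))"
      by (simp add: r L_F)
  next
    fix \<theta> :: "('i, 'd) par" and x :: "('i, 'k) dat"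
    show "norm (F_grad \<eta> r \<theta> x) \<le> K_F * (1 + norm x) ^ \<rho> * (1 + norm \<theta> ^ (2 * r + 1))"
      unfolding K_F by (rule F_grad_bound[OF \<eta>])
  qed
  have part4: "(\<forall>(x::('i, 'k) dat) v. v \<bullet> (A x *v v) \<ge> 0 \<and> v \<bullet> (B x *v v) \<ge> 0) \<and>
      (\<forall>(\<theta>::('i, 'd) par) \<theta>' (x::('i, 'k) dat).
         (\<theta> - \<theta>') \<bullet> (F_grad \<eta> r \<theta> x - F_grad \<eta> r \<theta>' x)
           \<ge> (\<theta> - \<theta>') \<bullet> (A x *v (\<theta> - \<theta>')) * (norm \<theta> ^ (2 * r) + norm \<theta>' ^ (2 * r))
             - (\<theta> - \<theta>') \<bullet> (B x *v (\<theta> - \<theta>')) * (norm \<theta> ^ rbar + norm \<theta>' ^ rbar))"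
    (is "?nonneg \<and> ?monotone")
  proof
    show ?nonneg using \<eta> unfolding Av Bv by simp
    show ?monotone
    proof (intro allI)
      fix \<theta> \<theta>' :: "('i, 'd) par" and x :: "('i, 'k) dat"
      show "(\<theta> - \<theta>') \<bullet> (F_grad \<eta> r \<theta> x - F_grad \<eta> r \<theta>' x)
           \<ge> (\<theta> - \<theta>') \<bullet> (A x *v (\<theta> - \<theta>')) * (norm \<theta> ^ (2 * r) + norm \<theta>' ^ (2 * r))
             - (\<theta> - \<theta>') \<bullet> (B x *v (\<theta> - \<theta>')) * (norm \<theta> ^ rbar + norm \<theta>' ^ rbar)"
        using F_grad_monotone[OF \<eta>, where \<theta>=\<theta> and \<theta>'=\<theta>' and x=x and r=r] unfolding Av Bv by simp
    qed
  qed
  have part5: "(a \<in> eigenvalues (\<integral>\<omega>. A (Xs 0 \<omega>) \<partial>M) \<and>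
       (\<forall>l \<in> eigenvalues (\<integral>\<omega>. A (Xs 0 \<omega>) \<partial>M). a \<le> l) \<and> a > 0) \<and>
      (b \<in> eigenvalues (\<integral>\<omega>. B (Xs 0 \<omega>) \<partial>M) \<and>
       (\<forall>l \<in> eigenvalues (\<integral>\<omega>. B (Xs 0 \<omega>) \<partial>M). l \<le> b) \<and> b \<ge> 0)"
    unfolding eigA eigB using \<open>\<eta> > 0\<close> by (simp add: r)
  show ?thesis
    using part1 part2 part3 part4 part5 by blast
qed

end
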